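(* Let $G$ be any infinite graph and let $\{(\alpha(\mathcal C_X),\alpha_X),\mathfrak a_{X',X}\}$ be a $\mathcal C$-system of $G$. Then the induced space $\alpha G$ is an $\Omega$-compactification of $G$. In particular, $\mathfrak FG$ and the tangle compactification $\vartheta G$ are $\Omega$-compactifications of $G$.
   Context: $G$ is regarded as a 1-complex: edges are copies of $[0,1]$; inner edge points have their usual neighbourhoods, a basic open neighbourhood of a vertex $u$ is a union of half-open intervals $[u,j_e)$, one for each edge $e$ at $u$. $\mathring E$ denotes the set of all inner edge points. $\mathcal X$ is the set of finite subsets of $V(G)$; $\mathcal C_X$ the set of components of $G-X$, discrete; for $X\subseteq X'$, $\phi_{X',X}$ sends a component of $G-X'$ to the component of $G-X$ containing it. For an end $\omega$, $C(X,\omega)$ is the component of $G-X$ containing a tail of each ray of $\omega$, and $\Omega(X,\omega)$ the set of ends $\omega'$ with $C(X,\omega')=C(X,\omega)$. $\mathcal VG$ is $G\cup\Omega$ ($\Omega$ the set of ends) with the topology generated by the open sets of the 1-complex and the sets $C(X,\omega)\cup\Omega(X,\omega)\cup\mathring E(X,C(X,\omega))$ ($\mathring E(X,C)$: inner points of edges between $X$ and $C$). An $\Omega$-compactification of $G$ is a compact space $\alpha G$ containing $\mathcal VG$ as a dense subspace such that $\alpha G\setminus\mathring E$ is Hausdorff. A $\mathcal C$-system is a family of Hausdorff compactifications $(\alpha(\mathcal C_X),\alpha_X)$ of $\mathcal C_X$ ($\alpha_X:\mathcal C_X\to\alpha(\mathcal C_X)$ a dense embedding into a compact Hausdorff space),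 $X\in\mathcal X$, together with continuous maps $\mathfrak a_{X',X}:\alpha(\mathcal C_{X'})\to\alpha(\mathcal C_X)$ for $X\subseteq X'$ forming an inverse system (compatible, identity for $X=X'$) and satisfying $\mathfrak a_{X',X}\circ\alpha_{X'}=\alpha_X\circ\phi_{X',X}$. Let $\mathcal I_\alpha=\varprojlim\alpha(\mathcal C_X)$ and $\pi_X$ the projections. The induced space $\alpha G=G\cup\mathcal I_\alpha$ has the topology generated by the open sets of the 1-complex $G$ and, for $X\in\mathcal X$ and $O$ open in $\alpha(\mathcal C_X)$, the sets $\bigcup\mathcal C\cup\mathring E(X,\bigcup\mathcal C)\cup\pi_X^{-1}(O)$ with $\mathcal C=\alpha_X^{-1}(O)$. Each end $\omega$ is identified with $(\alpha_X(C(X,\omega)))_X\in\mathcal I_\alpha$. $\vartheta G$ is the space induced by the $\mathcal C$-system $\{(\mathcal U_X,c_X),f_{X',X}\}$: $\mathcal U_X$ is the set of ultrafilters on $\mathcal C_X$ with Stone topology (basic sets $\{U:\mathcal C\in U\}$), $c_X(C)$ the principal ultrafilter generated by $\{C\}$, $f_{X',X}(U')=\{\mathcal C\subseteq\mathcal C_X:\exists\mathcal C'\in U',\mathcal C\supseteq\phi_{X',X}[\mathcal C']\}$. $\mathfrak FG$ is the space induced by the $\mathcal C$-system $\{(\mathfrak F_X,c_X),\mathfrak f_{X',X}\}$, where: $\mathcal C_X(Y)$ is the set of components of $G-X$ with neighbourhood exactly $Y$; $\mathrm{crit}(X)=\{Y\subseteq X:\mathcal C_X(Y)\text{ infinite}\}$;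 for $Y\in\mathrm{crit}(X)$, $\mathcal F_X(Y)$ is the set of $\mathcal C\subseteq\mathcal C_X$ containing a cofinite subset of $\mathcal C_X(Y)$; $\mathfrak F_X=\{c_X(C)\}_{C\in\mathcal C_X}\cup\{\mathcal F_X(Y)\}_{Y\in\mathrm{crit}(X)}$ with topology generated by $\{\mathcal F:\mathcal C\in\mathcal F\}$; $\mathfrak f_{X',X}(c_{X'}(C'))=c_X(\phi_{X',X}(C'))$, $\mathfrak f_{X',X}(\mathcal F_{X'}(Y))=\mathcal F_X(Y)$ if $Y\subseteq X$, and $=c_X(C)$ if $Y\not\subseteq X$, $C$ the component of $G-X$ including $\bigcup\mathcal C_{X'}(Y)$. *)

theory Defs
  imports "HOL-Analysis.Analysis"
begin

section \<open>Graphs, components, ends\<close>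

record 'v graph =
  verts :: "'v set"
  edges :: "'v set set"

definition simple_graph :: "'v graph \<Rightarrow> bool" where
  "simple_graph G \<longleftrightarrow>
     edges G \<subseteq> {{u, v} | u v. u \<in> verts G \<and> v \<in> verts G \<and> u \<noteq> v}"

definition fin_sets :: "'v graph \<Rightarrow> 'v set set" where
  "fin_sets G = {X. finite X \<and> X \<subseteq> verts G}"

definition connected_off :: "'v graph \<Rightarrow> 'v set \<Rightarrow> ('v \<times> 'v) set" where
  "connected_off G X =
     {(u, v). u \<in> verts G - X \<and> v \<in> verts G - X \<and>
        (u, v) \<in> {(a, b). a \<notin> X \<and> b \<notin> X \<and> {a, b} \<in> edges G}\<^sup>*}"

text \<open>A component of \<open>G - X\<close> is an induced subgraph of \<open>G\<close>; it is represented by its vertex set.\<close>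

definition comps :: "'v graph \<Rightarrow> 'v set \<Rightarrow> 'v set set" where
  "comps G X = (verts G - X) // connected_off G X"

definition comp_map :: "'v graph \<Rightarrow> 'v set \<Rightarrow> 'v set \<Rightarrow> 'v set \<Rightarrow> 'v set" where
  "comp_map G X' X C' = (THE C. C \<in> comps G X \<and> C' \<subseteq> C)"

text \<open>A ray is given by its enumeration from its starting vertex, which the ray determines.\<close>

definition rays :: "'v graph \<Rightarrow> (nat \<Rightarrow> 'v) set" where
  "rays G = {r. inj r \<and> (\<forall>n. {r n, r (Suc n)} \<in> edges G)}"

definition has_tail_in :: "(nat \<Rightarrow> 'v) \<Rightarrow> 'v set \<Rightarrow> bool" where
  "has_tail_in r C \<longleftrightarrow> (\<exists>n. \<forall>m\<ge>n. r m \<in> C)"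

definition ray_equiv :: "'v graph \<Rightarrow> ((nat \<Rightarrow> 'v) \<times> (nat \<Rightarrow> 'v)) set" where
  "ray_equiv G =
     {(r, s). r \<in> rays G \<and> s \<in> rays G \<and>
        (\<forall>X\<in>fin_sets G. \<exists>C\<in>comps G X. has_tail_in r C \<and> has_tail_in s C)}"

definition ends :: "'v graph \<Rightarrow> (nat \<Rightarrow> 'v) set set" where
  "ends G = rays G // ray_equiv G"

definition end_comp :: "'v graph \<Rightarrow> 'v set \<Rightarrow> (nat \<Rightarrow> 'v) set \<Rightarrow> 'v set" where
  "end_comp G X \<omega> = (THE C. C \<in> comps G X \<and> (\<forall>r\<in>\<omega>. has_tail_in r C))"

definition ends_at :: "'v graph \<Rightarrow> 'v set \<Rightarrow> (nat \<Rightarrow> 'v) set \<Rightarrow> (nat \<Rightarrow> 'v) set set" where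
  "ends_at G X \<omega> = {\<omega>' \<in> ends G. end_comp G X \<omega>' = end_comp G X \<omega>}"


section \<open>The 1-complex of a graph\<close>

text \<open>
  Every edge \<open>e\<close> is identified with \<open>[0,1]\<close> so that \<open>0\<close> is an arbitrarily chosen endvertex
  \<open>origin e\<close>; \<open>Inner e t\<close> with \<open>0 < t < 1\<close> is the inner point of \<open>e\<close> with parameter \<open>t\<close>.
\<close>

datatype 'v point = Vertex 'v | Inner "'v set" real

definition origin :: "'v set \<Rightarrow> 'v" where
  "origin e = (SOME v. v \<in> e)"

definition dist_from :: "'v \<Rightarrow> 'v set \<Rightarrow> real \<Rightarrow> real" where
  "dist_from u e t = (if u = origin e then t else 1 - t)"

definition inner_points :: "'v graph \<Rightarrow> 'v point set" where
  "inner_points G = {Inner e t | e t. e \<in> edges G \<and> 0 < t \<and> t < 1}"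

text \<open>
  The basic open neighbourhood of \<open>u\<close> that contains, for each edge \<open>e\<close> at \<open>u\<close>, the half-open
  interval from \<open>u\<close> to the inner point of \<open>e\<close> at distance \<open>\<delta> e\<close> from \<open>u\<close>.
\<close>

definition vertex_nbhd :: "'v graph \<Rightarrow> 'v \<Rightarrow> ('v set \<Rightarrow> real) \<Rightarrow> 'v point set" where
  "vertex_nbhd G u \<delta> =
     insert (Vertex u)
       {Inner e t | e t. e \<in> edges G \<and> u \<in> e \<and> 0 < t \<and> t < 1 \<and> dist_from u e t < \<delta> e}"

definition complex_topology :: "'v graph \<Rightarrow> 'v point topology" where
  "complex_topology G = topology_generated_by
     ({Inner e ` I | e I. e \<in> edges G \<and> open I \<and> I \<subseteq> {0<..<1}} \<union>
      {vertex_nbhd G u \<delta> | u \<delta>. u \<in> verts G \<and> (\<forall>e. 0 < \<delta> e \<and> \<delta> e < 1)})"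

definition subgraph_points :: "'v graph \<Rightarrow> 'v set \<Rightarrow> 'v point set" where
  "subgraph_points G C =
     Vertex ` C \<union> {Inner e t | e t. e \<in> edges G \<and> e \<subseteq> C \<and> 0 < t \<and> t < 1}"

definition cross_points :: "'v graph \<Rightarrow> 'v set \<Rightarrow> 'v set \<Rightarrow> 'v point set" where
  "cross_points G X D =
     {Inner e t | e t. e \<in> edges G \<and> (\<exists>x\<in>X. \<exists>c\<in>D. e = {x, c}) \<and> 0 < t \<and> t < 1}"


section \<open>The space \<open>\<V>G\<close> and \<open>\<Omega>\<close>-compactifications\<close>

definition VG :: "'v graph \<Rightarrow> ('v point + (nat \<Rightarrow> 'v) set) topology" where
  "VG G = topology_generated_by
     ({Inl ` W | W. openin (complex_topology G) W} \<union>
      {Inl ` (subgraph_points G (end_comp G X \<omega>) \<union> cross_points G X (end_comp G X \<omega>))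
         \<union> Inr ` ends_at G X \<omega> | X \<omega>. X \<in> fin_sets G \<and> \<omega> \<in> ends G})"

text \<open>
  The inclusion of \<open>\<V>G\<close> as a dense subspace is expressed by a dense embedding \<open>\<iota>\<close>.
  Compactness does not include the Hausdorff property.
\<close>

definition Omega_compactification ::
    "'v graph \<Rightarrow> 'b topology \<Rightarrow> ('v point + (nat \<Rightarrow> 'v) set \<Rightarrow> 'b) \<Rightarrow> bool" where
  "Omega_compactification G T \<iota> \<longleftrightarrow>
     compact_space T \<and>
     embedding_map (VG G) T \<iota> \<and>
     T closure_of (\<iota> ` topspace (VG G)) = topspace T \<and>
     Hausdorff_space (subtopology T (topspace T - \<iota> ` Inl ` inner_points G))"


section \<open>\<open>\<C>\<close>-systems and induced spaces\<close>

text \<open>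
  \<open>A X\<close> is the compactification of the discrete space of components of \<open>G - X\<close>, \<open>\<alpha> X\<close> its
  embedding, and \<open>\<aa> X' X\<close> the bonding map from \<open>A X'\<close> to \<open>A X\<close> for \<open>X \<subseteq> X'\<close>.
\<close>

definition Hausdorff_compactification :: "'c topology \<Rightarrow> 'a topology \<Rightarrow> ('c \<Rightarrow> 'a) \<Rightarrow> bool" where
  "Hausdorff_compactification S K f \<longleftrightarrow>
     compact_space K \<and> Hausdorff_space K \<and> embedding_map S K f \<and>
     K closure_of (f ` topspace S) = topspace K"

definition C_system ::
    "'v graph \<Rightarrow> ('v set \<Rightarrow> 'a topology) \<Rightarrow> ('v set \<Rightarrow> 'v set \<Rightarrow> 'a) \<Rightarrow>
     ('v set \<Rightarrow> 'v set \<Rightarrow> 'a \<Rightarrow> 'a) \<Rightarrow> bool" where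
  "C_system G A \<alpha> \<aa> \<longleftrightarrow>
     (\<forall>X\<in>fin_sets G. Hausdorff_compactification (discrete_topology (comps G X)) (A X) (\<alpha> X)) \<and>
     (\<forall>X\<in>fin_sets G. \<forall>X'\<in>fin_sets G. X \<subseteq> X' \<longrightarrow> continuous_map (A X') (A X) (\<aa> X' X)) \<and>
     (\<forall>X\<in>fin_sets G. \<forall>x\<in>topspace (A X). \<aa> X X x = x) \<and>
     (\<forall>X\<in>fin_sets G. \<forall>X'\<in>fin_sets G. \<forall>X''\<in>fin_sets G. X \<subseteq> X' \<longrightarrow> X' \<subseteq> X'' \<longrightarrow>
        (\<forall>x\<in>topspace (A X''). \<aa> X' X (\<aa> X'' X' x) = \<aa> X'' X x)) \<and>
     (\<forall>X\<in>fin_sets G. \<forall>X'\<in>fin_sets G. X \<subseteq> X' \<longrightarrow>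
        (\<forall>C'\<in>comps G X'. \<aa> X' X (\<alpha> X' C') = \<alpha> X (comp_map G X' X C')))"

definition inverse_limit ::
    "'v graph \<Rightarrow> ('v set \<Rightarrow> 'a topology) \<Rightarrow> ('v set \<Rightarrow> 'v set \<Rightarrow> 'a \<Rightarrow> 'a) \<Rightarrow> ('v set \<Rightarrow> 'a) set" where
  "inverse_limit G A \<aa> =
     {x \<in> (\<Pi>\<^sub>E X\<in>fin_sets G. topspace (A X)).
        \<forall>X\<in>fin_sets G. \<forall>X'\<in>fin_sets G. X \<subseteq> X' \<longrightarrow> \<aa> X' X (x X') = x X}"

definition limit_nbhd ::
    "'v graph \<Rightarrow> ('v set \<Rightarrow> 'a topology) \<Rightarrow> ('v set \<Rightarrow> 'v set \<Rightarrow> 'a) \<Rightarrow>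
     ('v set \<Rightarrow> 'v set \<Rightarrow> 'a \<Rightarrow> 'a) \<Rightarrow> 'v set \<Rightarrow> 'a set \<Rightarrow> ('v point + ('v set \<Rightarrow> 'a)) set" where
  "limit_nbhd G A \<alpha> \<aa> X Q =
     (let \<C> = {C \<in> comps G X. \<alpha> X C \<in> Q}
      in Inl ` ((\<Union>C\<in>\<C>. subgraph_points G C) \<union> cross_points G X (\<Union>\<C>))
           \<union> Inr ` {x \<in> inverse_limit G A \<aa>. x X \<in> Q})"

definition induced_space ::
    "'v graph \<Rightarrow> ('v set \<Rightarrow> 'a topology) \<Rightarrow> ('v set \<Rightarrow> 'v set \<Rightarrow> 'a) \<Rightarrow>
     ('v set \<Rightarrow> 'v set \<Rightarrow> 'a \<Rightarrow> 'a) \<Rightarrow> ('v point + ('v set \<Rightarrow> 'a)) topology" where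
  "induced_space G A \<alpha> \<aa> = topology_generated_by
     ({Inl ` W | W. openin (complex_topology G) W} \<union>
      {limit_nbhd G A \<alpha> \<aa> X Q | X Q. X \<in> fin_sets G \<and> openin (A X) Q})"

text \<open>The identity on \<open>G\<close>, together with the identification of ends with points of the limit.\<close>

definition induced_inclusion ::
    "'v graph \<Rightarrow> ('v set \<Rightarrow> 'v set \<Rightarrow> 'a) \<Rightarrow>
     'v point + (nat \<Rightarrow> 'v) set \<Rightarrow> 'v point + ('v set \<Rightarrow> 'a)" where
  "induced_inclusion G \<alpha> =
     map_sum id (\<lambda>\<omega>. \<lambda>X\<in>fin_sets G. \<alpha> X (end_comp G X \<omega>))"


section \<open>The tangle compactification\<close>

definition ultrafilter_on :: "'c set \<Rightarrow> 'c set set \<Rightarrow> bool" where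
  "ultrafilter_on S U \<longleftrightarrow>
     U \<subseteq> Pow S \<and> S \<in> U \<and> {} \<notin> U \<and>
     (\<forall>P\<in>U. \<forall>Q\<in>U. P \<inter> Q \<in> U) \<and>
     (\<forall>P\<in>U. \<forall>Q. P \<subseteq> Q \<longrightarrow> Q \<subseteq> S \<longrightarrow> Q \<in> U) \<and>
     (\<forall>P. P \<subseteq> S \<longrightarrow> P \<in> U \<or> S - P \<in> U)"

text \<open>The topology on a set \<open>\<F>\<close> of families of subsets of \<open>S\<close> with subbasic sets
  \<open>{F \<in> \<F>. P \<in> F}\<close>.\<close>

definition stone_topology :: "'c set \<Rightarrow> 'c set set set \<Rightarrow> 'c set set topology" where
  "stone_topology S \<F> = topology_generated_by {{F \<in> \<F>. P \<in> F} | P. P \<subseteq> S}"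

definition principal_uf :: "'v graph \<Rightarrow> 'v set \<Rightarrow> 'v set \<Rightarrow> 'v set set set" where
  "principal_uf G X C = {\<C>. \<C> \<subseteq> comps G X \<and> C \<in> \<C>}"

definition uf_space :: "'v graph \<Rightarrow> 'v set \<Rightarrow> 'v set set set topology" where
  "uf_space G X = stone_topology (comps G X) {U. ultrafilter_on (comps G X) U}"

definition uf_map ::
    "'v graph \<Rightarrow> 'v set \<Rightarrow> 'v set \<Rightarrow> 'v set set set \<Rightarrow> 'v set set set" where
  "uf_map G X' X U' = {\<C>. \<C> \<subseteq> comps G X \<and> (\<exists>\<C>'\<in>U'. comp_map G X' X ` \<C>' \<subseteq> \<C>)}"

definition tangle_space :: "'v graph \<Rightarrow> ('v point + ('v set \<Rightarrow> 'v set set set)) topology" where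
  "tangle_space G = induced_space G (uf_space G) (principal_uf G) (uf_map G)"


section \<open>The space \<open>\<FF>G\<close>\<close>

definition nbhd :: "'v graph \<Rightarrow> 'v set \<Rightarrow> 'v set" where
  "nbhd G C = {v \<in> verts G - C. \<exists>c\<in>C. {v, c} \<in> edges G}"

definition comps_nbhd :: "'v graph \<Rightarrow> 'v set \<Rightarrow> 'v set \<Rightarrow> 'v set set" where
  "comps_nbhd G X Y = {C \<in> comps G X. nbhd G C = Y}"

definition crit :: "'v graph \<Rightarrow> 'v set \<Rightarrow> 'v set set" where
  "crit G X = {Y. Y \<subseteq> X \<and> infinite (comps_nbhd G X Y)}"

definition crit_filter :: "'v graph \<Rightarrow> 'v set \<Rightarrow> 'v set \<Rightarrow> 'v set set set" where
  "crit_filter G X Y =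
     {\<C>. \<C> \<subseteq> comps G X \<and>
        (\<exists>\<D>. \<D> \<subseteq> comps_nbhd G X Y \<and> finite (comps_nbhd G X Y - \<D>) \<and> \<D> \<subseteq> \<C>)}"

definition frakF_set :: "'v graph \<Rightarrow> 'v set \<Rightarrow> 'v set set set set" where
  "frakF_set G X = principal_uf G X ` comps G X \<union> crit_filter G X ` crit G X"

definition frakF_level :: "'v graph \<Rightarrow> 'v set \<Rightarrow> 'v set set set topology" where
  "frakF_level G X = stone_topology (comps G X) (frakF_set G X)"

text \<open>
  The two cases of the definition are disjoint on \<open>frakF_set G X'\<close>, and \<open>C'\<close> and \<open>Y\<close> are
  determined by \<open>F\<close>.
\<close>

definition frakF_map ::
    "'v graph \<Rightarrow> 'v set \<Rightarrow> 'v set \<Rightarrow> 'v set set set \<Rightarrow> 'v set set set" where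
  "frakF_map G X' X F =
     (if F \<in> principal_uf G X' ` comps G X'
      then principal_uf G X
             (comp_map G X' X (THE C'. C' \<in> comps G X' \<and> F = principal_uf G X' C'))
      else let Y = (THE Y. Y \<in> crit G X' \<and> F = crit_filter G X' Y)
           in if Y \<subseteq> X then crit_filter G X Y
              else principal_uf G X (THE C. C \<in> comps G X \<and> \<Union>(comps_nbhd G X' Y) \<subseteq> C))"

definition frakF_space :: "'v graph \<Rightarrow> ('v point + ('v set \<Rightarrow> 'v set set set)) topology" where
  "frakF_space G = induced_space G (frakF_level G) (principal_uf G) (frakF_map G)"

end

theory Submission imports Defs begin

text \<open>
  Every point \<open>x\<close> of the inverse limit has a neighbourhood base of sets given by some \<open>X\<close> and some
  open \<open>Q \<subseteq> \<alpha>(\<C>\<^sub>X)\<close>.  If such sets cover the limit, then compactness of the product of the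
  \<open>\<alpha>(\<C>\<^sub>X)\<close> yields finitely many of them and a finite \<open>Z\<close> such that their pullbacks cover all of
  \<open>\<alpha>(\<C>\<^sub>Z)\<close>; only the compact finite graph \<open>G[Z]\<close> remains, which gives compactness of \<open>\<alpha>G\<close>.  The
  subspace topology on \<open>\<V>G\<close> is the right one because each \<open>\<alpha>\<^sub>X(C)\<close> is isolated in
  \<open>\<alpha>(\<C>\<^sub>X)\<close>.  Both special cases consist of spaces of filters on \<open>\<C>\<^sub>X\<close> in which the bonding maps
  push filters forward along \<open>\<phi>\<^bsub>X',X\<^esub>\<close>.
\<close>

section \<open>Components and ends\<close>

text \<open>The sets around a limit point contain the open edges between \<open>X\<close> and the
  chosen components in full. Hence, once such sets cover everything over a finite \<open>Z\<close>,
  only the finitely many edges inside \<open>Z\<close> are left. The price is that a vertex with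
  infinitely many neighbours may not be separable from a limit point: the neighbourhoods used here
  can overlap, but only in inner edge points, and these are removed before the Hausdorff property is
  claimed. The infinite vertex set makes all level spaces nonempty, so that a point of one level can
  be completed to a point of the product. For \<open>FG\<close> the bonding maps are given by cases
  and definite descriptions. They are shown to agree with the pushforward on the filters concerned;
  identity, composition and continuity then become statements about preimages under component maps,
  proved once for both systems. Compactness of its levels rests on the finiteness of
  \<open>X\<close>: neighbourhoods of components are subsets of \<open>X\<close>, so the components
  fall into finitely many classes, each finite or governed by one cofinite filter.\<close>

definition step_off :: "'v graph \<Rightarrow> 'v set \<Rightarrow> ('v \<times> 'v) set" where
  "step_off G X = {(a, b). a \<notin> X \<and> b \<notin> X \<and> {a, b} \<in> edges G}"

lemma connected_off_iff:
  "(u, v) \<in> connected_off G X \<longleftrightarrow>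
     u \<in> verts G - X \<and> v \<in> verts G - X \<and> (u, v) \<in> (step_off G X)\<^sup>*"
  by (auto simp: connected_off_def step_off_def)

lemma sym_step_off_rtrancl: "sym ((step_off G X)\<^sup>*)"
  by (rule sym_rtrancl) (auto simp: sym_def step_off_def insert_commute)

lemma equiv_connected_off: "equiv (verts G - X) (connected_off G X)"
proof (rule equivI)
  show "refl_on (verts G - X) (connected_off G X)"
    by (auto simp: refl_on_def connected_off_iff)
  show "sym (connected_off G X)"
    using sym_step_off_rtrancl[of G X] by (auto simp: sym_def connected_off_iff)
  show "trans (connected_off G X)"
    by (auto simp: trans_def connected_off_iff)
qed (auto simp: connected_off_iff)

lemma comps_subset: "C \<in> comps G X \<Longrightarrow> C \<subseteq> verts G - X"
  unfolding comps_def using equiv_connected_off in_quotient_imp_subset by metis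

lemma comps_nonempty: "C \<in> comps G X \<Longrightarrow> C \<noteq> {}"
  unfolding comps_def using equiv_connected_off in_quotient_imp_non_empty by metis

lemma comps_eq: "C \<in> comps G X \<Longrightarrow> D \<in> comps G X \<Longrightarrow> v \<in> C \<Longrightarrow> v \<in> D \<Longrightarrow> C = D"
  unfolding comps_def using quotient_disj[OF equiv_connected_off] by blast

lemma comps_cover: "v \<in> verts G \<Longrightarrow> v \<notin> X \<Longrightarrow> \<exists>C\<in>comps G X. v \<in> C"
  unfolding comps_def using Union_quotient[OF equiv_connected_off, of G X] by blast

lemma comps_connected:
  assumes "C \<in> comps G X" "u \<in> C" "v \<in> C"
  shows "(u, v) \<in> (step_off G X)\<^sup>*"
  using assms quotient_eq_iff[OF equiv_connected_off, of C G X C u v]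
  unfolding comps_def by (auto simp: connected_off_iff)

lemma comps_closed:
  assumes "C \<in> comps G X" "u \<in> C" "v \<in> verts G" "v \<notin> X" "(u, v) \<in> (step_off G X)\<^sup>*"
  shows "v \<in> C"
proof -
  have "u \<in> verts G - X" using comps_subset assms(1,2) by blast
  then have "(u, v) \<in> connected_off G X" using assms by (simp add: connected_off_iff)
  then show ?thesis
    using assms(1,2) in_quotient_imp_closed[OF equiv_connected_off] unfolding comps_def by metis
qed

text \<open>A finite \<open>X\<close> cannot exhaust an infinite vertex set. This is how infinity of
  the graph enters: it keeps every level space nonempty.\<close>

lemma comps_ne_set:
  assumes "infinite (verts G)" "X \<in> fin_sets G"
  shows "comps G X \<noteq> {}"
proof -
  have "verts G - X \<noteq> {}" using assms by (metis fin_sets_def finite.emptyI finite_Diff2 mem_Collect_eq)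
  then show ?thesis using comps_cover[of _ G X] by fastforce
qed

locale sgraph =
  fixes G :: "'v graph"
  assumes simple: "simple_graph G"
begin

lemma edgeE:
  assumes "e \<in> edges G"
  obtains u v where "e = {u, v}" "u \<in> verts G" "v \<in> verts G" "u \<noteq> v"
  using assms simple unfolding simple_graph_def by blast

lemma edge_verts: "{u, v} \<in> edges G \<Longrightarrow> u \<in> verts G \<and> v \<in> verts G"
  by (metis edgeE insert_iff singletonD)

lemma comps_edge:
  assumes "C \<in> comps G X" "u \<in> C" "{u, v} \<in> edges G" "v \<notin> X"
  shows "v \<in> C"
proof -
  have "u \<notin> X" using comps_subset assms by blast
  then have "(u, v) \<in> step_off G X" using assms by (simp add: step_off_def)
  then show ?thesis using comps_closed[OF assms(1,2)] edge_verts[OF assms(3)] assms(4) by blast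
qed

lemma nbhd_comps:
  assumes "C \<in> comps G X"
  shows "nbhd G C \<subseteq> X"
proof
  fix v assume "v \<in> nbhd G C"
  then obtain c where "c \<in> C" "v \<notin> C" "{c, v} \<in> edges G"
    by (auto simp: nbhd_def insert_commute)
  then show "v \<in> X" using comps_edge[OF assms] by blast
qed

lemma step_off_stays:
  assumes "(u, v) \<in> (step_off G X)\<^sup>*" "u \<in> C"
    and "\<And>a b. a \<in> C \<Longrightarrow> (a, b) \<in> step_off G X \<Longrightarrow> b \<in> C"
  shows "v \<in> C"
  using assms(1,2) by (induction rule: rtrancl_induct) (use assms(3) in auto)

text \<open>This justifies the definite description in \<open>comp_map\<close>. A walk avoiding
  \<open>X'\<close> also avoids the smaller \<open>X\<close>, so all of \<open>C'\<close> falls into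
  the component of any one of its vertices; disjointness gives uniqueness.\<close>

lemma ex1_comp:
  assumes "C' \<in> comps G X'" "X \<subseteq> X'"
  shows "\<exists>!C. C \<in> comps G X \<and> C' \<subseteq> C"
proof -
  obtain v where v: "v \<in> C'" using comps_nonempty assms(1) by blast
  then have "v \<in> verts G" "v \<notin> X" using comps_subset[OF assms(1)] assms(2) by auto
  then obtain C where C: "C \<in> comps G X" "v \<in> C" using comps_cover by metis
  have "C' \<subseteq> C"
  proof
    fix w assume w: "w \<in> C'"
    have "(v, w) \<in> (step_off G X')\<^sup>*" using comps_connected assms(1) v w by metis
    moreover have "step_off G X' \<subseteq> step_off G X" using assms(2) by (auto simp: step_off_def)
    ultimately have "(v, w) \<in> (step_off G X)\<^sup>*" using rtrancl_mono by blast
    then show "w \<in> C" using comps_closed[OF C] comps_subset[OF assms(1)] w assms(2) by blast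
  qed
  with C v show ?thesis by (meson comps_eq subsetD)
qed

lemma comp_map:
  assumes "C' \<in> comps G X'" "X \<subseteq> X'"
  shows "comp_map G X' X C' \<in> comps G X" "C' \<subseteq> comp_map G X' X C'"
  using theI'[OF ex1_comp[OF assms]] unfolding comp_map_def by auto

lemma comp_map_eq:
  assumes "C' \<in> comps G X'" "X \<subseteq> X'" "C \<in> comps G X" "v \<in> C" "v \<in> C'"
  shows "comp_map G X' X C' = C"
  using comp_map[OF assms(1,2)] assms(3-5) comps_eq by (metis subsetD)

lemma comp_map_refl: "C \<in> comps G X \<Longrightarrow> comp_map G X X C = C"
  using comp_map_eq comps_nonempty by (metis equals0I order_refl)

lemma comp_map_trans:
  assumes "C \<in> comps G X''" "X \<subseteq> X'" "X' \<subseteq> X''"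
  shows "comp_map G X' X (comp_map G X'' X' C) = comp_map G X'' X C"
proof -
  obtain v where "v \<in> C" using comps_nonempty assms(1) by blast
  then show ?thesis
    using comp_map[OF assms(1,3)] comp_map[OF assms(1), of X] comp_map_eq assms
    by (meson order_trans subsetD)
qed

text \<open>A walk off \<open>X\<close> that leaves \<open>C\<close> would have to pass through a
  neighbour of \<open>C\<close>, and these all lie in \<open>X\<close>. This lets components at
  level \<open>X'\<close> with neighbourhood \<open>Y \<subseteq> X\<close> be reused at level
  \<open>X\<close>.\<close>

lemma comps_coarsen:
  assumes "C \<in> comps G X'" "X \<subseteq> X'" "nbhd G C \<subseteq> X"
  shows "C \<in> comps G X"
proof -
  define D where "D = comp_map G X' X C"
  have D: "D \<in> comps G X" "C \<subseteq> D" using comp_map[OF assms(1,2)] by (auto simp: D_def)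
  obtain v where v: "v \<in> C" using comps_nonempty assms(1) by blast
  have "D \<subseteq> C"
  proof
    fix w assume "w \<in> D"
    then have "(v, w) \<in> (step_off G X)\<^sup>*" using comps_connected[OF D(1)] D(2) v by blast
    then show "w \<in> C"
    proof (rule step_off_stays)
      fix a b assume "a \<in> C" "(a, b) \<in> step_off G X"
      then have "a \<in> C" "{b, a} \<in> edges G" "b \<notin> X" "b \<in> verts G"
        using edge_verts[of a b] by (simp_all add: step_off_def insert_commute)
      then show "b \<in> C" using assms(3) unfolding nbhd_def by blast
    qed (rule v)
  qed
  with D show ?thesis by auto
qed

text \<open>Deleting \<open>X' - X\<close> touches no vertex of \<open>C\<close>, so walks inside
  \<open>C\<close> survive. Together with \<open>finite_comps_meeting\<close> this shows that all
  but finitely many components of \<open>G - X\<close> persist when a finite \<open>X'\<close> is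
  deleted.\<close>

lemma comps_refine:
  assumes "C \<in> comps G X" "X \<subseteq> X'" "C \<inter> X' = {}"
  shows "C \<in> comps G X'"
proof -
  obtain v where v: "v \<in> C" using comps_nonempty assms(1) by blast
  then have "v \<in> verts G" "v \<notin> X'" using comps_subset[OF assms(1)] assms(3) by auto
  then obtain D where D: "D \<in> comps G X'" "v \<in> D" using comps_cover by metis
  have "D \<subseteq> C" using comp_map[OF D(1) assms(2)] comp_map_eq[OF D(1) assms(2,1) v D(2)] by simp
  moreover have "C \<subseteq> D"
  proof
    fix w assume "w \<in> C"
    then have "(v, w) \<in> (step_off G X)\<^sup>*" using comps_connected[OF assms(1) v] by blast
    then have "w \<in> C \<inter> D"
    proof (rule step_off_stays)
      fix a b assume a: "a \<in> C \<inter> D" and ab: "(a, b) \<in> step_off G X"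
      then have b: "b \<in> C" using comps_edge[OF assms(1), of a b] by (simp add: step_off_def)
      then have "b \<notin> X'" using assms(3) by blast
      then show "b \<in> C \<inter> D" using b comps_edge[OF D(1), of a b] a ab
        by (simp add: step_off_def)
    qed (use v D in auto)
    then show "w \<in> D" by blast
  qed
  ultimately show ?thesis using D by auto
qed

text \<open>Any vertex in \<open>C \<inter> Y\<close> determines \<open>C\<close>, so there are at
  most as many of these components as elements of \<open>Y\<close>.\<close>

lemma finite_comps_meeting:
  assumes "finite Y"
  shows "finite {C \<in> comps G X. C \<inter> Y \<noteq> {}}"
proof -
  have "{C \<in> comps G X. C \<inter> Y \<noteq> {}} \<subseteq> (\<lambda>y. THE C. C \<in> comps G X \<and> y \<in> C) ` Y"
  proof
    fix C assume C: "C \<in> {C \<in> comps G X. C \<inter> Y \<noteq> {}}"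
    then obtain y where "y \<in> C" "y \<in> Y" by blast
    moreover have "(THE C. C \<in> comps G X \<and> y \<in> C) = C"
      using C \<open>y \<in> C\<close> by (intro the_equality) (auto dest: comps_eq[of _ G X C y])
    ultimately show "C \<in> (\<lambda>y. THE C. C \<in> comps G X \<and> y \<in> C) ` Y" by blast
  qed
  then show ?thesis using assms finite_surj by blast
qed

section \<open>Rays and ends\<close>

text \<open>Injectivity makes the ray meet \<open>X\<close> only finitely often; beyond the last
  visit consecutive vertices are adjacent off \<open>X\<close>, so the ray stays in one
  component.\<close>

lemma ray_has_tail:
  assumes "r \<in> rays G" "finite X"
  shows "\<exists>C\<in>comps G X. has_tail_in r C"
proof -
  have inj: "inj r" and edge: "\<And>n. {r n, r (Suc n)} \<in> edges G"
    using assms(1) by (auto simp: rays_def)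
  have "finite (r -` X)" using inj assms(2) by (simp add: finite_vimageI)
  then obtain n where n: "\<And>m. m \<ge> n \<Longrightarrow> r m \<notin> X"
    unfolding finite_nat_set_iff_bounded by (meson leD vimageI2)
  have "r n \<in> verts G" using edge_verts[OF edge[of n]] by blast
  then obtain C where C: "C \<in> comps G X" "r n \<in> C" using comps_cover[of "r n" G X] n[of n] by blast
  have "r m \<in> C" if "m \<ge> n" for m
    using that
  proof (induction rule: dec_induct)
    case (step k)
    then show ?case using comps_edge[OF C(1) _ edge[of k]] n[of "Suc k"] by simp
  qed (rule C(2))
  then show ?thesis using C(1) by (auto simp: has_tail_in_def)
qed

lemma tail_comp_unique:
  assumes "C \<in> comps G X" "D \<in> comps G X" "has_tail_in r C" "has_tail_in r D"
  shows "C = D"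
proof -
  obtain m n where "\<forall>k\<ge>m. r k \<in> C" "\<forall>k\<ge>n. r k \<in> D"
    using assms(3,4) by (auto simp: has_tail_in_def)
  then have "r (max m n) \<in> C" "r (max m n) \<in> D" by auto
  then show ?thesis using assms comps_eq by metis
qed

lemma equiv_ray_equiv: "equiv (rays G) (ray_equiv G)"
proof (rule equivI)
  show "refl_on (rays G) (ray_equiv G)"
    using ray_has_tail by (fastforce simp: refl_on_def ray_equiv_def fin_sets_def)
  show "sym (ray_equiv G)" by (auto simp: sym_def ray_equiv_def)
  show "trans (ray_equiv G)"
    unfolding trans_def ray_equiv_def using tail_comp_unique by (smt (verit) case_prod_conv mem_Collect_eq)
qed (auto simp: ray_equiv_def)

text \<open>Justifies the definite description in \<open>end_comp\<close>: the component found for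
  one representative serves every equivalent ray, and a ray has tails in only one component.\<close>

lemma end_comp:
  assumes "\<omega> \<in> ends G" "X \<in> fin_sets G"
  shows "end_comp G X \<omega> \<in> comps G X" "r \<in> \<omega> \<Longrightarrow> has_tail_in r (end_comp G X \<omega>)"
proof -
  obtain s where s: "s \<in> rays G" "\<omega> = ray_equiv G `` {s}"
    using assms(1) unfolding ends_def by (metis quotientE)
  obtain C where C: "C \<in> comps G X" "has_tail_in s C"
    using ray_has_tail[OF s(1), of X] assms(2) by (auto simp: fin_sets_def)
  have "\<exists>!C. C \<in> comps G X \<and> (\<forall>r\<in>\<omega>. has_tail_in r C)"
  proof (rule ex1I[of _ C])
    show "C \<in> comps G X \<and> (\<forall>r\<in>\<omega>. has_tail_in r C)"
    proof (intro conjI ballI)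
      fix r assume "r \<in> \<omega>"
      then obtain D where "D \<in> comps G X" "has_tail_in s D" "has_tail_in r D"
        using s(2) assms(2) by (auto simp: ray_equiv_def)
      then show "has_tail_in r C" using C tail_comp_unique by metis
    qed (rule C(1))
    have "s \<in> \<omega>" using s equiv_class_self[OF equiv_ray_equiv] by blast
    then show "D = C" if "D \<in> comps G X \<and> (\<forall>r\<in>\<omega>. has_tail_in r D)" for D
      using that C tail_comp_unique by metis
  qed
  from theI'[OF this] show "end_comp G X \<omega> \<in> comps G X"
      "r \<in> \<omega> \<Longrightarrow> has_tail_in r (end_comp G X \<omega>)"
    unfolding end_comp_def by blast+
qed

lemma ends_nonempty: "\<omega> \<in> ends G \<Longrightarrow> \<exists>r\<in>rays G. r \<in> \<omega>"
  unfolding ends_def by (erule quotientE) (use equiv_class_self[OF equiv_ray_equiv] in blast)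

text \<open>Exactly the compatibility that makes the components chosen by an end into a thread of
  the inverse system.\<close>

lemma comp_map_end_comp:
  assumes "\<omega> \<in> ends G" "X \<in> fin_sets G" "X' \<in> fin_sets G" "X \<subseteq> X'"
  shows "comp_map G X' X (end_comp G X' \<omega>) = end_comp G X \<omega>"
proof -
  obtain r where r: "r \<in> \<omega>" using ends_nonempty assms(1) by blast
  have "has_tail_in r (comp_map G X' X (end_comp G X' \<omega>))"
    using end_comp(2)[OF assms(1,3) r] comp_map(2)[OF end_comp(1)[OF assms(1,3)] assms(4)]
    by (auto simp: has_tail_in_def)
  then show ?thesis
    by (rule tail_comp_unique[OF comp_map(1)[OF end_comp(1)[OF assms(1,3)] assms(4)]
      end_comp(1)[OF assms(1,2)] _ end_comp(2)[OF assms(1,2) r]])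
qed

lemma ends_eqI:
  assumes "\<omega> \<in> ends G" "\<omega>' \<in> ends G" "\<And>X. X \<in> fin_sets G \<Longrightarrow> end_comp G X \<omega> = end_comp G X \<omega>'"
  shows "\<omega> = \<omega>'"
proof -
  obtain r s where r: "r \<in> \<omega>" "r \<in> rays G" and s: "s \<in> \<omega>'" "s \<in> rays G"
    using ends_nonempty[OF assms(1)] ends_nonempty[OF assms(2)] by blast
  have "\<exists>C\<in>comps G X. has_tail_in r C \<and> has_tail_in s C" if "X \<in> fin_sets G" for X
    using end_comp[OF assms(1) that] end_comp[OF assms(2) that] assms(3)[OF that] r s by auto
  then have "(r, s) \<in> ray_equiv G" using r s by (simp add: ray_equiv_def)
  then show ?thesis
    using quotient_eqI[OF equiv_ray_equiv _ _ r(1) s(1)] assms(1,2) unfolding ends_def by simp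
qed

end

section \<open>The 1-complex\<close>

text \<open>The graph part contributed by one component, in the neighbourhoods of \<open>VG\<close>
  as well as in \<open>limit_nbhd\<close>; a common name makes the two topologies
  comparable.\<close>

definition comp_points :: "'v graph \<Rightarrow> 'v set \<Rightarrow> 'v set \<Rightarrow> 'v point set" where
  "comp_points G X C = subgraph_points G C \<union> cross_points G X C"

lemma Vertex_in_comp_points [simp]: "Vertex v \<in> comp_points G X C \<longleftrightarrow> v \<in> C"
  by (auto simp: comp_points_def subgraph_points_def cross_points_def)

lemma Inner_in_comp_points [simp]:
  "Inner e t \<in> comp_points G X C \<longleftrightarrow>
     e \<in> edges G \<and> 0 < t \<and> t < 1 \<and> (e \<subseteq> C \<or> (\<exists>x\<in>X. \<exists>c\<in>C. e = {x, c}))"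
  by (auto simp: comp_points_def subgraph_points_def cross_points_def)

lemma limit_nbhd_eq:
  "limit_nbhd G A \<alpha> \<aa> X Q =
     Inl ` (\<Union>C\<in>{C \<in> comps G X. \<alpha> X C \<in> Q}. comp_points G X C)
       \<union> Inr ` {x \<in> inverse_limit G A \<aa>. x X \<in> Q}"
proof -
  have "cross_points G X (\<Union>\<C>) = (\<Union>C\<in>\<C>. cross_points G X C)" for \<C>
    unfolding cross_points_def by blast
  then show ?thesis by (simp add: limit_nbhd_def comp_points_def UN_Un_distrib Let_def)
qed

lemma openin_complex_Inner:
  "e \<in> edges G \<Longrightarrow> open I \<Longrightarrow> I \<subseteq> {0<..<1} \<Longrightarrow> openin (complex_topology G) (Inner e ` I)"
  unfolding complex_topology_def by (rule topology_generated_by_Basis) blast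

lemma openin_complex_vertex_nbhd:
  "u \<in> verts G \<Longrightarrow> (\<And>e. 0 < \<delta> e \<and> \<delta> e < 1) \<Longrightarrow> openin (complex_topology G) (vertex_nbhd G u \<delta>)"
  unfolding complex_topology_def by (rule topology_generated_by_Basis) blast

lemma topspace_complex: "topspace (complex_topology G) = Vertex ` verts G \<union> inner_points G"
proof
  show "topspace (complex_topology G) \<subseteq> Vertex ` verts G \<union> inner_points G"
    by (auto simp: complex_topology_def inner_points_def vertex_nbhd_def)
  have "Vertex u \<in> topspace (complex_topology G)" if "u \<in> verts G" for u
    using openin_subset[OF openin_complex_vertex_nbhd[OF that, of "\<lambda>_. 1/2"]]
    by (auto simp: vertex_nbhd_def)
  moreover have "Inner e t \<in> topspace (complex_topology G)" if "e \<in> edges G" "0 < t" "t < 1" for e t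
    using openin_subset[OF openin_complex_Inner[OF that(1), of "{0<..<1}"]] that by auto
  ultimately show "Vertex ` verts G \<union> inner_points G \<subseteq> topspace (complex_topology G)"
    by (auto simp: inner_points_def)
qed

context sgraph
begin

text \<open>An edge at a vertex of \<open>C\<close> has its other end in \<open>C\<close> or in
  \<open>X\<close>, so the set contains the whole open star of each of its vertices.\<close>

lemma openin_comp_points:
  assumes "C \<in> comps G X"
  shows "openin (complex_topology G) (comp_points G X C)"
proof -
  define E where "E = {e \<in> edges G. e \<subseteq> C \<or> (\<exists>x\<in>X. \<exists>c\<in>C. e = {x, c})}"
  have nbhd: "vertex_nbhd G u (\<lambda>_. 1/2) \<subseteq> comp_points G X C" if u: "u \<in> C" for u
  proof
    fix p assume "p \<in> vertex_nbhd G u (\<lambda>_. 1/2)"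
    then consider "p = Vertex u"
      | e t where "p = Inner e t" "e \<in> edges G" "u \<in> e" "0 < t" "t < 1"
      by (auto simp: vertex_nbhd_def)
    then show "p \<in> comp_points G X C"
    proof cases
      case 2
      obtain v where v: "e = {u, v}"
        using edgeE[OF \<open>e \<in> edges G\<close>] \<open>u \<in> e\<close> by (metis insertE insert_commute singletonD)
      show ?thesis
      proof (cases "v \<in> X")
        case False
        then have "e \<subseteq> C" using comps_edge[OF assms u, of v] 2 v u by auto
        then show ?thesis using 2 by simp
      next
        case True
        moreover have "e = {v, u}" using v by blast
        ultimately have "\<exists>x\<in>X. \<exists>c\<in>C. e = {x, c}" using u by blast
        then show ?thesis using 2 by simp
      qed
    qed (use u in simp)
  qed
  \<comment> \<open>The open edges are added in full, so the radius 1/2 is arbitrary; the vertex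
    neighbourhoods only have to stay inside the set.\<close>
  have "comp_points G X C
      = (\<Union>e\<in>E. Inner e ` {0<..<1}) \<union> (\<Union>u\<in>C. vertex_nbhd G u (\<lambda>_. 1/2))" (is "?L = ?R")
  proof
    show "?L \<subseteq> ?R"
    proof
      fix p assume "p \<in> ?L"
      then consider v where "p = Vertex v" "v \<in> C" | e t where "p = Inner e t" "e \<in> E" "t \<in> {0<..<1}"
        by (cases p) (auto simp: E_def)
      then show "p \<in> ?R"
      proof cases
        case 2
        then show ?thesis by blast
      qed (auto simp: vertex_nbhd_def)
    qed
    show "?R \<subseteq> ?L" using nbhd by (force simp: E_def)
  qed
  moreover have "openin (complex_topology G) ?R"
  proof (intro openin_Un openin_Union ballI; clarify)
    fix e assume "e \<in> E"
    then show "openin (complex_topology G) (Inner e ` {0<..<1})"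
      by (intro openin_complex_Inner) (auto simp: E_def)
  next
    fix u assume "u \<in> C"
    then show "openin (complex_topology G) (vertex_nbhd G u (\<lambda>_. 1/2))"
      using comps_subset[OF assms] by (intro openin_complex_vertex_nbhd) auto
  qed
  ultimately show ?thesis by simp
qed

text \<open>The case to watch is an edge from \<open>x\<close> in \<open>X' - X\<close> into
  \<open>C'\<close>: at level \<open>X\<close> the vertex \<open>x\<close> itself belongs to the
  larger component, so the cross edge becomes an edge inside it.\<close>

lemma comp_points_mono:
  assumes "C' \<in> comps G X'" "X \<subseteq> X'"
  shows "comp_points G X' C' \<subseteq> comp_points G X (comp_map G X' X C')"
proof
  note C = comp_map[OF assms]
  fix p assume p: "p \<in> comp_points G X' C'"
  show "p \<in> comp_points G X (comp_map G X' X C')"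
  proof (cases p)
    case (Vertex v)
    then show ?thesis using p C by auto
  next
    case (Inner e t)
    then have e: "e \<in> edges G" "0 < t" "t < 1" using p by auto
    consider "e \<subseteq> C'" | x c where "x \<in> X'" "c \<in> C'" "e = {x, c}" using p Inner by auto
    then have "e \<subseteq> comp_map G X' X C' \<or> (\<exists>x\<in>X. \<exists>c\<in>comp_map G X' X C'. e = {x, c})"
    proof cases
      case 1
      then show ?thesis using C by blast
    next
      case (2 x c)
      then have c: "c \<in> comp_map G X' X C'" "{c, x} \<in> edges G"
        using C e by (auto simp: insert_commute)
      show ?thesis
      proof (cases "x \<in> X")
        case False
        then show ?thesis using comps_edge[OF C(1) c] 2 c by blast
      qed (use 2 c in blast)
    qed
    then show ?thesis using Inner e by simp
  qed
qed

text \<open>The closed edge is a continuous image of the unit interval; a compact superset of the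
  open edge is all that the covering argument requires.\<close>

lemma compactin_edge:
  assumes e: "e \<in> edges G"
  shows "\<exists>K. compactin (complex_topology G) K \<and> Inner e ` {0<..<1} \<subseteq> K"
proof -
  obtain u v where uv: "e = {u, v}" "u \<in> verts G" "v \<in> verts G" "u \<noteq> v" using edgeE[OF e] .
  define a where "a = origin e"
  have "a \<in> e" using uv unfolding a_def origin_def by (intro someI[of "\<lambda>v. v \<in> e"]) blast
  then obtain b where ab: "e = {a, b}" "a \<in> verts G" "b \<in> verts G" "a \<noteq> b"
    using uv by (metis insertE insert_commute singletonD)
  define p where "p t = (if t = 0 then Vertex a else if t = 1 then Vertex b else Inner e t)" for t :: real
  have "continuous_map (top_of_set {0..1}) (complex_topology G) p"
    unfolding complex_topology_def
  proof (rule continuous_on_generated_topo)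
    fix U assume "U \<in> {Inner e ` I |e I. e \<in> edges G \<and> open I \<and> I \<subseteq> {0<..<1}} \<union>
      {vertex_nbhd G u \<delta> |u \<delta>. u \<in> verts G \<and> (\<forall>e. 0 < \<delta> e \<and> \<delta> e < 1)}"
    then consider e' I where "U = Inner e' ` I" "open I" "I \<subseteq> {0<..<1}"
      | w \<delta> where "U = vertex_nbhd G w \<delta>" "\<And>e. 0 < \<delta> e" "\<And>e. \<delta> e < 1" by blast
    then have "\<exists>W. open W \<and> p -` U \<inter> {0..1} = W \<inter> {0..1}"
    proof cases
      case (1 e' I)
      have "p t \<in> U \<longleftrightarrow> t \<in> (if e' = e then I else {})" for t
        using 1(3) unfolding 1(1) by (auto simp: p_def split: if_splits)
      then have "p -` U = (if e' = e then I else {})" by blast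
      moreover have "open (if e' = e then I else {})" using 1(2) by simp
      ultimately show ?thesis by blast
    next
      case (2 w \<delta>)
      \<comment> \<open>The part of the interval mapped near \<open>w\<close>: an initial segment if
        \<open>w\<close> is the origin, a final segment if it is the other end, nothing otherwise.
        The first two cases exclude each other because there are no loops.\<close>
      define W where "W = (if w = a then {..<\<delta> e} else if w = b then {1 - \<delta> e<..} else {})"
      have "p t \<in> U \<longleftrightarrow> t \<in> W" if t: "t \<in> {0..1}" for t
      proof -
        consider "t = 0" | "t = 1" | "0 < t" "t < 1" using t by fastforce
        then show ?thesis
        proof cases
          case 3
          then have "p t = Inner e t" by (simp add: p_def)
          moreover have "w \<in> e \<longleftrightarrow> w = a \<or> w = b" using ab(1) by simp
          moreover have "dist_from a e t = t" "dist_from b e t = 1 - t"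
            using ab(4) by (simp_all add: dist_from_def a_def)
          ultimately show ?thesis using e 3 by (auto simp: 2(1) vertex_nbhd_def W_def)
        qed (use 2(2,3)[of e] ab(4) in \<open>auto simp: 2(1) p_def vertex_nbhd_def W_def\<close>)
      qed
      moreover have "open W" by (simp add: W_def)
      ultimately show ?thesis by blast
    qed
    then show "openin (top_of_set {0..1}) (p -` U \<inter> topspace (top_of_set {0..1}))"
      by (auto simp: openin_open Int_commute)
  next
    show "p ` topspace (top_of_set {0..1}) \<subseteq> \<Union>({Inner e ` I |e I. e \<in> edges G \<and> open I \<and> I \<subseteq> {0<..<1}} \<union>
      {vertex_nbhd G u \<delta> |u \<delta>. u \<in> verts G \<and> (\<forall>e. 0 < \<delta> e \<and> \<delta> e < 1)})"
      using ab e topspace_complex[of G] unfolding complex_topology_def topology_generated_by_topspace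
      by (auto simp: p_def inner_points_def)
  qed
  then have "compactin (complex_topology G) (p ` {0..1})"
    by (rule image_compactin[rotated]) (simp add: compactin_subtopology)
  moreover have "Inner e ` {0<..<1} \<subseteq> p ` {0..1}"
  proof
    fix q assume "q \<in> Inner e ` {0<..<1}"
    then obtain t where "0 < t" "t < 1" "q = p t" by (auto simp: p_def)
    then show "q \<in> p ` {0..1}" by auto
  qed
  ultimately show ?thesis by blast
qed

text \<open>Edges inside \<open>X\<close> are members of the finite set \<open>Pow X\<close>, so
  finitely many compact edges suffice.\<close>

lemma compactin_finite_subgraph:
  assumes "X \<in> fin_sets G"
  shows "\<exists>K. compactin (complex_topology G) K \<and> subgraph_points G X \<subseteq> K"
proof -
  have X: "finite X" "X \<subseteq> verts G" using assms by (auto simp: fin_sets_def)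
  obtain K where K: "\<And>e. e \<in> edges G \<Longrightarrow> compactin (complex_topology G) (K e)"
      "\<And>e. e \<in> edges G \<Longrightarrow> Inner e ` {0<..<1} \<subseteq> K e"
    using compactin_edge by metis
  define L where "L = Vertex ` X \<union> \<Union>(K ` {e \<in> edges G. e \<subseteq> X})"
  have "finite {e \<in> edges G. e \<subseteq> X}" using X by (auto intro: finite_subset[of _ "Pow X"])
  then have "compactin (complex_topology G) (\<Union>(K ` {e \<in> edges G. e \<subseteq> X}))"
    using K(1) by (intro compactin_Union) auto
  moreover have "compactin (complex_topology G) (Vertex ` X)"
    using X by (intro finite_imp_compactin) (auto simp: topspace_complex)
  ultimately have "compactin (complex_topology G) L" unfolding L_def by (rule compactin_Un[rotated])
  moreover have "subgraph_points G X \<subseteq> L"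
  proof
    fix p assume "p \<in> subgraph_points G X"
    then consider "p \<in> Vertex ` X" | e t where "e \<in> edges G" "e \<subseteq> X" "p = Inner e t" "t \<in> {0<..<1}"
      unfolding subgraph_points_def by auto
    then show "p \<in> L"
    proof cases
      case 2
      then have "p \<in> K e" using K(2)[of e] by blast
      then show ?thesis using 2 unfolding L_def by blast
    qed (simp add: L_def)
  qed
  ultimately show ?thesis by blast
qed

end

section \<open>The space induced by a \<open>\<C>\<close>-system\<close>

locale csystem = sgraph G
  for G :: "'v graph" +
  fixes A :: "'v set \<Rightarrow> 'a topology" and \<alpha> \<aa>
  assumes inf_verts: "infinite (verts G)" and C_system: "C_system G A \<alpha> \<aa>"
begin

abbreviation T where "T \<equiv> induced_space G A \<alpha> \<aa>"
abbreviation lim where "lim \<equiv> inverse_limit G A \<aa>"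
abbreviation N where "N \<equiv> limit_nbhd G A \<alpha> \<aa>"

lemma fin_Un: "X \<in> fin_sets G \<Longrightarrow> Y \<in> fin_sets G \<Longrightarrow> X \<union> Y \<in> fin_sets G"
  by (auto simp: fin_sets_def)

lemma fin_Union: "finite \<X> \<Longrightarrow> \<X> \<subseteq> fin_sets G \<Longrightarrow> \<Union>\<X> \<in> fin_sets G"
  by (auto simp: fin_sets_def)

lemmas system =
  C_system[unfolded C_system_def, THEN conjunct1, rule_format]
  C_system[unfolded C_system_def, THEN conjunct2, THEN conjunct1, rule_format]
  C_system[unfolded C_system_def, THEN conjunct2, THEN conjunct2, THEN conjunct2, THEN conjunct1,
    rule_format]
  C_system[unfolded C_system_def, THEN conjunct2, THEN conjunct2, THEN conjunct2, THEN conjunct2,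
    rule_format]

section \<open>Level spaces, bonding maps and threads\<close>

lemma level:
  assumes "X \<in> fin_sets G"
  shows "compact_space (A X)" "Hausdorff_space (A X)"
    "embedding_map (discrete_topology (comps G X)) (A X) (\<alpha> X)"
    "A X closure_of (\<alpha> X ` comps G X) = topspace (A X)"
  using system(1)[OF assms] by (simp_all add: Hausdorff_compactification_def)

lemma bond:
  assumes "X \<in> fin_sets G" "X' \<in> fin_sets G" "X \<subseteq> X'"
  shows "continuous_map (A X') (A X) (\<aa> X' X)"
    "C' \<in> comps G X' \<Longrightarrow> \<aa> X' X (\<alpha> X' C') = \<alpha> X (comp_map G X' X C')"
    "y \<in> topspace (A X') \<Longrightarrow> \<aa> X' X y \<in> topspace (A X)"
  using system(2)[OF assms] system(4)[OF assms] by (auto simp: continuous_map_def)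

lemma bond_trans:
  assumes "X \<in> fin_sets G" "X' \<in> fin_sets G" "X'' \<in> fin_sets G" "X \<subseteq> X'" "X' \<subseteq> X''"
    "y \<in> topspace (A X'')"
  shows "\<aa> X' X (\<aa> X'' X' y) = \<aa> X'' X y"
  using system(3)[OF assms] .

lemma emb_in:
  assumes "X \<in> fin_sets G" "C \<in> comps G X"
  shows "\<alpha> X C \<in> topspace (A X)"
proof -
  have "continuous_map (discrete_topology (comps G X)) (A X) (\<alpha> X)"
    using level(3)[OF assms(1)]
    by (simp add: embedding_map_def homeomorphic_eq_everything_map continuous_map_in_subtopology)
  then show ?thesis using assms(2) by (auto simp: continuous_map_def)
qed

lemma emb_inj:
  assumes "X \<in> fin_sets G"
  shows "inj_on (\<alpha> X) (comps G X)"
  using level(3)[OF assms] by (simp add: embedding_map_def homeomorphic_eq_everything_map)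

lemma emb_dense:
  assumes "X \<in> fin_sets G" "openin (A X) Q" "Q \<noteq> {}"
  shows "\<exists>C\<in>comps G X. \<alpha> X C \<in> Q"
  using level(4)[OF assms(1)] assms(2,3) unfolding dense_intersects_open by blast

text \<open>By density, an open set meeting the discrete image only in \<open>\<alpha> X C\<close> contains nothing else.\<close>

lemma emb_isolated:
  assumes X: "X \<in> fin_sets G" and C: "C \<in> comps G X"
  shows "openin (A X) {\<alpha> X C}"
proof -
  have "open_map (discrete_topology (comps G X)) (subtopology (A X) (\<alpha> X ` comps G X)) (\<alpha> X)"
    using homeomorphic_imp_open_map[OF level(3)[OF X, unfolded embedding_map_def]]
    unfolding topspace_discrete_topology .
  then have "openin (subtopology (A X) (\<alpha> X ` comps G X)) (\<alpha> X ` {C})"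
    using C unfolding open_map_def by (metis empty_subsetI insert_subset openin_discrete_topology)
  then obtain Q where Q: "openin (A X) Q" "{\<alpha> X C} = Q \<inter> \<alpha> X ` comps G X"
    by (auto simp: openin_subtopology)
  have "openin (A X) (Q - {\<alpha> X C})"
    using Q(1) emb_in[OF X C] level(2)[OF X]
    by (intro openin_diff) (auto simp: closedin_Hausdorff_sing_eq)
  then have "Q - {\<alpha> X C} = {}" using emb_dense[OF X] Q(2) by blast
  then have "Q = {\<alpha> X C}" using Q(2) by blast
  then show ?thesis using Q(1) by simp
qed

lemma lim_in: "x \<in> lim \<Longrightarrow> X \<in> fin_sets G \<Longrightarrow> x X \<in> topspace (A X)"
  unfolding inverse_limit_def by blast

lemma lim_bond: "x \<in> lim \<Longrightarrow> X \<in> fin_sets G \<Longrightarrow> X' \<in> fin_sets G \<Longrightarrow> X \<subseteq> X' \<Longrightarrow> \<aa> X' X (x X') = x X"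
  unfolding inverse_limit_def by blast

lemma lim_eqI:
  assumes "x \<in> lim" "y \<in> lim" "\<And>X. X \<in> fin_sets G \<Longrightarrow> x X = y X"
  shows "x = y"
  using assms unfolding inverse_limit_def by (intro PiE_ext[of x _ _ y]) auto

section \<open>Basic open sets of the induced space\<close>

lemma Inl_in_N:
  "Inl p \<in> N X Q \<longleftrightarrow> (\<exists>C\<in>comps G X. \<alpha> X C \<in> Q \<and> p \<in> comp_points G X C)"
  by (auto simp: limit_nbhd_eq)

lemma Inr_in_N: "Inr x \<in> N X Q \<longleftrightarrow> x \<in> lim \<and> x X \<in> Q"
  by (auto simp: limit_nbhd_eq)

text \<open>On the limit this is compatibility of threads; on the graph it is
  \<open>comp_points_mono\<close> together with the fact that bonding maps extend the component
  maps.\<close>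

lemma N_mono:
  assumes X: "X \<in> fin_sets G" "X' \<in> fin_sets G" "X \<subseteq> X'" and Q: "\<And>y. y \<in> Q' \<Longrightarrow> \<aa> X' X y \<in> Q"
  shows "N X' Q' \<subseteq> N X Q"
proof
  fix p assume p: "p \<in> N X' Q'"
  show "p \<in> N X Q"
  proof (cases p)
    case (Inl q)
    then obtain C where C: "C \<in> comps G X'" "\<alpha> X' C \<in> Q'" "q \<in> comp_points G X' C"
      using p by (auto simp: Inl_in_N)
    then have "\<alpha> X (comp_map G X' X C) \<in> Q" using Q bond(2)[OF X C(1)] by metis
    then show ?thesis
      unfolding Inl Inl_in_N using comp_map(1)[OF C(1) X(3)] comp_points_mono[OF C(1) X(3)] C(3) by blast
  next
    case (Inr x)
    then show ?thesis using p Q lim_bond[OF _ X] by (metis Inr_in_N)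
  qed
qed

lemma openin_Inl: "openin (complex_topology G) W \<Longrightarrow> openin T (Inl ` W)"
  unfolding induced_space_def by (rule topology_generated_by_Basis) blast

lemma openin_N: "X \<in> fin_sets G \<Longrightarrow> openin (A X) Q \<Longrightarrow> openin T (N X Q)"
  unfolding induced_space_def by (rule topology_generated_by_Basis) blast

lemma empty_fin [simp]: "{} \<in> fin_sets G"
  by (simp add: fin_sets_def)

lemma comp_points_subset:
  assumes "C \<in> comps G X"
  shows "comp_points G X C \<subseteq> topspace (complex_topology G)"
  using openin_subset[OF openin_comp_points[OF assms]] .

lemma topspace_T: "topspace T = Inl ` topspace (complex_topology G) \<union> Inr ` lim"
proof
  show "topspace T \<subseteq> Inl ` topspace (complex_topology G) \<union> Inr ` lim"
  proof
    fix p assume "p \<in> topspace T"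
    then consider W where "openin (complex_topology G) W" "p \<in> Inl ` W" | X Q where "p \<in> N X Q"
      by (auto simp: induced_space_def)
    then show "p \<in> Inl ` topspace (complex_topology G) \<union> Inr ` lim"
    proof cases
      case 1
      then show ?thesis using openin_subset by blast
    next
      case 2
      then show ?thesis using comp_points_subset by (cases p) (auto simp: Inl_in_N Inr_in_N)
    qed
  qed
  \<comment> \<open>The coordinate at the empty set already catches every thread.\<close>
  have "Inr ` lim \<subseteq> N {} (topspace (A {}))" using lim_in[of _ "{}"] by (auto simp: Inr_in_N)
  then show "Inl ` topspace (complex_topology G) \<union> Inr ` lim \<subseteq> topspace T"
    using openin_subset[OF openin_Inl[OF openin_topspace]]
      openin_subset[OF openin_N[OF empty_fin openin_topspace]] by blast
qed

lemma N_vimage_Inl: "openin (complex_topology G) (Inl -` N X Q)"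
proof -
  have "Inl -` N X Q = (\<Union>C\<in>{C \<in> comps G X. \<alpha> X C \<in> Q}. comp_points G X C)"
    by (auto simp: Inl_in_N)
  moreover have "openin (complex_topology G) (\<Union>C\<in>{C \<in> comps G X. \<alpha> X C \<in> Q}. comp_points G X C)"
    by (intro openin_Union) (auto intro: openin_comp_points)
  ultimately show ?thesis by simp
qed

lemma continuous_Inl: "continuous_map (complex_topology G) T Inl"
  unfolding induced_space_def
proof (rule continuous_on_generated_topo)
  fix U assume "U \<in> {Inl ` W |W. openin (complex_topology G) W} \<union> {N X Q |X Q. X \<in> fin_sets G \<and> openin (A X) Q}"
  then have "openin (complex_topology G) (Inl -` U)"
    using N_vimage_Inl by (auto simp: inj_vimage_image_eq)
  then show "openin (complex_topology G) (Inl -` U \<inter> topspace (complex_topology G))"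
    by auto
next
  show "Inl ` topspace (complex_topology G)
    \<subseteq> \<Union>({Inl ` W |W. openin (complex_topology G) W} \<union> {N X Q |X Q. X \<in> fin_sets G \<and> openin (A X) Q})"
    using topspace_T unfolding induced_space_def topology_generated_by_topspace by blast
qed

text \<open>The sets \<open>N X Q\<close> are only part of a subbasis, but the finite vertex sets
  are directed: conditions at \<open>X\<close> and \<open>X'\<close> can be pulled back to one
  condition at \<open>X \<union> X'\<close>. Sets coming from the 1-complex contain no limit
  point.\<close>

lemma limit_base:
  assumes "openin T U" "Inr x \<in> U"
  shows "\<exists>X Q. X \<in> fin_sets G \<and> openin (A X) Q \<and> Inr x \<in> N X Q \<and> N X Q \<subseteq> U"
proof -
  have "generate_topology_on ({Inl ` W |W. openin (complex_topology G) W} \<union>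
      {N X Q |X Q. X \<in> fin_sets G \<and> openin (A X) Q}) U"
    using openin_topology_generated_by assms(1) unfolding induced_space_def by blast
  then show ?thesis using assms(2)
  proof (induction rule: generate_topology_on.induct)
    case (Int a b)
    then obtain X Q X' Q' where
      1: "X \<in> fin_sets G" "openin (A X) Q" "Inr x \<in> N X Q" "N X Q \<subseteq> a" and
      2: "X' \<in> fin_sets G" "openin (A X') Q'" "Inr x \<in> N X' Q'" "N X' Q' \<subseteq> b"
      by blast
    define Z where "Z = X \<union> X'"
    have Z: "Z \<in> fin_sets G" "X \<subseteq> Z" "X' \<subseteq> Z" using 1 2 fin_Un by (auto simp: Z_def)
    define R where "R = {y \<in> topspace (A Z). \<aa> Z X y \<in> Q} \<inter> {y \<in> topspace (A Z). \<aa> Z X' y \<in> Q'}"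
    have "openin (A Z) R" unfolding R_def
      using bond(1) 1 2 Z by (intro openin_Int openin_continuous_map_preimage) auto
    moreover have "Inr x \<in> N Z R"
      using 1(3) 2(3) Z 1(1) 2(1) lim_in[of x Z] lim_bond[of x _ Z] by (simp add: R_def Inr_in_N)
    moreover have "N Z R \<subseteq> N X Q" "N Z R \<subseteq> N X' Q'"
      by (rule N_mono; use 1 2 Z in \<open>auto simp: R_def\<close>)+
    ultimately show ?case using 1(4) 2(4) Z(1) by blast
  next
    case (UN K)
    then obtain k where "k \<in> K" "Inr x \<in> k" by blast
    with UN.IH[of k] show ?case by blast
  qed auto
qed

text \<open>
  The set of threads of an inverse system is cut out of the compact product by closed conditions
  involving two coordinates each.  Finitely many of these only mention coordinates below some \<open>Z\<close>,
  so that each point of \<open>A Z\<close> yields a point of the product satisfying them.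
\<close>

lemma limit_cover:
  assumes J: "\<And>X Q. (X, Q) \<in> J \<Longrightarrow> X \<in> fin_sets G \<and> openin (A X) Q"
    and cover: "\<And>x. x \<in> lim \<Longrightarrow> \<exists>(X, Q)\<in>J. x X \<in> Q"
  shows "\<exists>J0 Z. finite J0 \<and> J0 \<subseteq> J \<and> Z \<in> fin_sets G \<and> (\<forall>(X, Q)\<in>J0. X \<subseteq> Z) \<and>
           (\<forall>y\<in>topspace (A Z). \<exists>(X, Q)\<in>J0. \<aa> Z X y \<in> Q)"
proof -
  define P where "P = product_topology A (fin_sets G)"
  have P: "compact_space P"
    using level(1) by (simp add: P_def compact_space_product_topology)
  have top: "topspace P = (\<Pi>\<^sub>E X\<in>fin_sets G. topspace (A X))" by (simp add: P_def)
  define u where "u = (\<lambda>(X, Q). {x \<in> topspace P. x X \<in> Q})"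
  \<comment> \<open>The points violating one compatibility condition form an open set, since two
    continuous maps into the Hausdorff space \<open>A X\<close> agree on a closed set.\<close>
  define w where "w = (\<lambda>(X, X'). topspace P - {x \<in> topspace P. \<aa> X' X (x X') = x X})"
  define R where "R = {(X, X'). X \<in> fin_sets G \<and> X' \<in> fin_sets G \<and> X \<subseteq> X'}"
  have proj: "continuous_map P (A X) (\<lambda>x. x X)" if "X \<in> fin_sets G" for X
    using that unfolding P_def by (rule continuous_map_product_projection)
  have open_u: "openin P (u j)" if "j \<in> J" for j
    using J that unfolding u_def
    by (cases j) (auto intro: openin_continuous_map_preimage[OF proj])
  have open_w: "openin P (w r)" if r: "r \<in> R" for r
  proof -
    obtain X X' where X: "r = (X, X')" "X \<in> fin_sets G" "X' \<in> fin_sets G" "X \<subseteq> X'"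
      using r by (auto simp: R_def)
    have "continuous_map P (A X) (\<aa> X' X \<circ> (\<lambda>x. x X'))"
      using proj[OF X(3)] bond(1)[OF X(2-4)] by (rule continuous_map_compose)
    then have "closedin P {x \<in> topspace P. (\<aa> X' X \<circ> (\<lambda>x. x X')) x = x X}"
      using closedin_continuous_maps_eq level(2)[OF X(2)] proj[OF X(2)] by blast
    then show ?thesis by (auto simp: X(1) w_def)
  qed
  have "topspace P \<subseteq> \<Union>(u ` J \<union> w ` R)"
  proof
    fix x assume x: "x \<in> topspace P"
    show "x \<in> \<Union>(u ` J \<union> w ` R)"
    proof (cases "x \<in> lim")
      case True
      then obtain X Q where "(X, Q) \<in> J" "x X \<in> Q" using cover by blast
      then have "x \<in> u (X, Q)" using x by (simp add: u_def)
      with \<open>(X, Q) \<in> J\<close> show ?thesis by blast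
    next
      case False
      then obtain X X' where "(X, X') \<in> R" "\<aa> X' X (x X') \<noteq> x X"
        using x by (auto simp: inverse_limit_def top R_def)
      then have "x \<in> w (X, X')" using x by (simp add: w_def)
      with \<open>(X, X') \<in> R\<close> show ?thesis by blast
    qed
  qed
  moreover have "\<forall>U\<in>u ` J \<union> w ` R. openin P U" using open_u open_w by blast
  ultimately have "\<exists>F. finite F \<and> F \<subseteq> u ` J \<union> w ` R \<and> topspace P \<subseteq> \<Union>F"
    using P[unfolded compact_space_alt, THEN spec, of "u ` J \<union> w ` R"] by simp
  then obtain F where F: "finite F" "F \<subseteq> u ` J \<union> w ` R" "topspace P \<subseteq> \<Union>F"
    by (elim exE conjE)
  obtain J0 where J0: "finite J0" "J0 \<subseteq> J" "F \<inter> u ` J = u ` J0"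
    using F(1) by (metis finite_Int finite_subset_image inf_le2)
  obtain R0 where R0: "finite R0" "R0 \<subseteq> R" "F \<inter> w ` R = w ` R0"
    using F(1) by (metis finite_Int finite_subset_image inf_le2)
  \<comment> \<open>Of a pair in \<open>R0\<close> the larger coordinate suffices: its partner is a
    subset.\<close>
  define Z where "Z = \<Union>(fst ` J0 \<union> snd ` R0)"
  have ZJ: "X \<subseteq> Z" if "(X, Q) \<in> J0" for X Q using that by (force simp: Z_def)
  have ZR: "X' \<subseteq> Z" if "(X, X') \<in> R0" for X X' using that by (force simp: Z_def)
  have "fst ` J0 \<union> snd ` R0 \<subseteq> fin_sets G"
    using J J0(2) R0(2) by (force simp: R_def)
  then have Z: "Z \<in> fin_sets G"
    unfolding Z_def using J0(1) R0(1) by (intro fin_Union) auto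
  have "\<exists>(X, Q)\<in>J0. \<aa> Z X y \<in> Q" if y: "y \<in> topspace (A Z)" for y
  proof -
    \<comment> \<open>Here infinity of the graph is used: default values \<open>d\<close> are needed
      at the coordinates not contained in \<open>Z\<close>.\<close>
    have "\<exists>z. z \<in> topspace (A X)" if "X \<in> fin_sets G" for X
      using comps_ne_set[OF inf_verts that] emb_in[OF that] by blast
    then obtain d where d: "\<And>X. X \<in> fin_sets G \<Longrightarrow> d X \<in> topspace (A X)" by metis
    \<comment> \<open>Below \<open>Z\<close> all coordinates are images of the single point
      \<open>y\<close>, hence compatible by \<open>bond_trans\<close>. So no \<open>w r\<close> with
      \<open>r\<close> in \<open>R0\<close> contains \<open>x\<close>, and the finite cover must
      reach it through some \<open>u j\<close>.\<close>
    define x where "x = (\<lambda>X\<in>fin_sets G. if X \<subseteq> Z then \<aa> Z X y else d X)"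
    have x: "x \<in> topspace P" using d bond(3)[OF _ Z _ y] by (simp add: top x_def)
    have "x \<notin> w r" if r: "r \<in> R0" for r
    proof -
      obtain X X' where X: "r = (X, X')" "X \<in> fin_sets G" "X' \<in> fin_sets G" "X \<subseteq> X'"
        using r R0(2) by (auto simp: R_def)
      then have "X' \<subseteq> Z" using ZR r by blast
      then show ?thesis using X Z y x bond_trans[of X X' Z y] by (auto simp: w_def x_def)
    qed
    then have not_w: "x \<notin> \<Union>(w ` R0)" by blast
    obtain U where U: "U \<in> F" "x \<in> U" using F(3) x by blast
    have "U \<in> u ` J0"
    proof (cases "U \<in> u ` J")
      case True
      then show ?thesis using U(1) J0(3) by blast
    next
      case False
      then have "U \<in> w ` R0" using U(1) F(2) R0(3) by blast
      then show ?thesis using U(2) not_w by blast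
    qed
    then have "\<exists>j\<in>J0. x \<in> u j" using U(2) by blast
    then obtain X Q where XQ: "(X, Q) \<in> J0" "x X \<in> Q" by (auto simp: u_def)
    then have "X \<in> fin_sets G" "X \<subseteq> Z" using J J0(2) ZJ by blast+
    then show ?thesis using XQ by (auto simp: x_def)
  qed
  moreover have "\<forall>(X, Q)\<in>J0. X \<subseteq> Z" using ZJ by blast
  ultimately show ?thesis using J0(1,2) Z by (intro exI[of _ J0] exI[of _ Z] conjI) simp_all
qed

lemma compact_T: "compact_space T"
  unfolding compact_space_alt
proof (intro allI impI)
  fix \<U> assume \<U>: "(\<forall>U\<in>\<U>. openin T U) \<and> topspace T \<subseteq> \<Union>\<U>"
  define J where "J = {(X, Q). X \<in> fin_sets G \<and> openin (A X) Q \<and> (\<exists>U\<in>\<U>. N X Q \<subseteq> U)}"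
  have "\<exists>(X, Q)\<in>J. x X \<in> Q" if x: "x \<in> lim" for x
  proof -
    have "Inr x \<in> topspace T" using x by (simp add: topspace_T)
    then obtain U where U: "U \<in> \<U>" "Inr x \<in> U" using \<U> by blast
    then obtain X Q where "X \<in> fin_sets G" "openin (A X) Q" "Inr x \<in> N X Q" "N X Q \<subseteq> U"
      using limit_base[of U x] \<U> by blast
    then have "(X, Q) \<in> J" "x X \<in> Q" using U(1) by (auto simp: J_def Inr_in_N)
    then show ?thesis by blast
  qed
  moreover have "X \<in> fin_sets G \<and> openin (A X) Q" if "(X, Q) \<in> J" for X Q
    using that by (simp add: J_def)
  ultimately have "\<exists>J0 Z. finite J0 \<and> J0 \<subseteq> J \<and> Z \<in> fin_sets G \<and> (\<forall>(X, Q)\<in>J0. X \<subseteq> Z) \<and>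
           (\<forall>y\<in>topspace (A Z). \<exists>(X, Q)\<in>J0. \<aa> Z X y \<in> Q)"
    by (intro limit_cover)
  then obtain J0 Z where J0: "finite J0" "J0 \<subseteq> J" and Z: "Z \<in> fin_sets G"
      and ZJ': "\<forall>(X, Q)\<in>J0. X \<subseteq> Z" and J0_cover': "\<forall>y\<in>topspace (A Z). \<exists>(X, Q)\<in>J0. \<aa> Z X y \<in> Q"
    by (elim exE conjE)
  have ZJ: "X \<subseteq> Z" if "(X, Q) \<in> J0" for X Q using bspec[OF ZJ' that] by simp
  have J0_cover: "\<exists>(X, Q)\<in>J0. \<aa> Z X y \<in> Q" if "y \<in> topspace (A Z)" for y
    using bspec[OF J0_cover' that] .
  obtain h where h: "\<And>j. j \<in> J \<Longrightarrow> h j \<in> \<U> \<and> N (fst j) (snd j) \<subseteq> h j"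
  proof -
    have "\<forall>j\<in>J. \<exists>U. U \<in> \<U> \<and> N (fst j) (snd j) \<subseteq> U" by (auto simp: J_def)
    then show ?thesis using that by metis
  qed
  obtain K where K: "compactin (complex_topology G) K" "subgraph_points G Z \<subseteq> K"
    using compactin_finite_subgraph[OF Z] by blast
  have "compactin T (Inl ` K)" using image_compactin[OF K(1) continuous_Inl] .
  then obtain F where F: "finite F" "F \<subseteq> \<U>" "Inl ` K \<subseteq> \<Union>F"
    using \<U> compactinD[of T "Inl ` K" \<U>] compactin_subset_topspace by (metis subset_trans)
  have N_cover: "N Z (topspace (A Z)) \<subseteq> \<Union>(h ` J0)"
  proof
    fix p assume p: "p \<in> N Z (topspace (A Z))"
    \<comment> \<open>The set \<open>N Z {y}\<close> need not be open; it only transports the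
      condition at \<open>y\<close> down to level \<open>X\<close> through
      \<open>N_mono\<close>.\<close>
    obtain y where y: "y \<in> topspace (A Z)" "p \<in> N Z {y}"
      using p emb_in[OF Z] lim_in[OF _ Z] by (cases p) (auto simp: Inl_in_N Inr_in_N)
    obtain X Q where XQ: "(X, Q) \<in> J0" "\<aa> Z X y \<in> Q" using J0_cover[OF y(1)] by blast
    have "X \<in> fin_sets G" using XQ J0 by (auto simp: J_def)
    then have "N Z {y} \<subseteq> N X Q" using N_mono[of X Z "{y}" Q] ZJ[OF XQ(1)] Z XQ(2) by blast
    moreover have "N X Q \<subseteq> h (X, Q)" using h[of "(X, Q)"] XQ J0(2) by auto
    ultimately show "p \<in> \<Union>(h ` J0)" using y(2) XQ(1) by blast
  qed
  have "topspace T \<subseteq> \<Union>(F \<union> h ` J0)"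
  proof
    fix p assume p: "p \<in> topspace T"
    \<comment> \<open>Vertices and edges not inside \<open>Z\<close> touch a component of
      \<open>G - Z\<close>, so their points lie in its \<open>comp_points\<close> and hence over the
      whole of \<open>A Z\<close>.\<close>
    have "p \<in> N Z (topspace (A Z)) \<or> p \<in> Inl ` subgraph_points G Z"
    proof (cases p)
      case (Inr x)
      then show ?thesis using p lim_in[OF _ Z] by (auto simp: Inr_in_N topspace_T)
    next
      case (Inl q)
      have q: "q \<in> Vertex ` verts G \<union> inner_points G"
        using p Inl by (auto simp: topspace_T topspace_complex)
      have N: "p \<in> N Z (topspace (A Z))" if "C \<in> comps G Z" "q \<in> comp_points G Z C" for C
        using that Inl emb_in[OF Z] by (auto simp: Inl_in_N)
      show ?thesis
      proof (cases q)
        case (Vertex v)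
        then have v: "v \<in> verts G" using q by (auto simp: inner_points_def)
        show ?thesis
        proof (cases "v \<in> Z")
          case True
          then show ?thesis using Inl Vertex by (auto simp: subgraph_points_def)
        next
          case False
          then obtain C where "C \<in> comps G Z" "v \<in> C" using comps_cover[OF v, of Z] by blast
          then show ?thesis using N Vertex by simp
        qed
      next
        case (Inner e t)
        then have e: "e \<in> edges G" "0 < t" "t < 1" using q by (auto simp: inner_points_def)
        show ?thesis
        proof (cases "e \<subseteq> Z")
          case True
          then show ?thesis using Inl Inner e by (auto simp: subgraph_points_def)
        next
          case False
          then obtain a b where ab: "e = {a, b}" "a \<in> verts G" "a \<notin> Z"
            using edgeE[OF e(1)] by (metis empty_subsetI insert_commute insert_subset)
          obtain C where C: "C \<in> comps G Z" "a \<in> C" using comps_cover[OF ab(2,3)] by blast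
          have "e \<subseteq> C \<or> (\<exists>x\<in>Z. \<exists>c\<in>C. e = {x, c})"
          proof (cases "b \<in> Z")
            case True
            then show ?thesis using ab(1) C(2) by (metis insert_commute)
          next
            case False
            then show ?thesis using comps_edge[OF C, of b] ab(1) C(2) e(1) by simp
          qed
          then show ?thesis using N[OF C(1)] Inner e by simp
        qed
      qed
    qed
    then show "p \<in> \<Union>(F \<union> h ` J0)"
    proof
      assume "p \<in> N Z (topspace (A Z))"
      then show ?thesis using subsetD[OF N_cover] unfolding Union_Un_distrib by (intro UnI2)
    next
      assume "p \<in> Inl ` subgraph_points G Z"
      then have "p \<in> Inl ` K" using subsetD[OF image_mono[OF K(2)]] by simp
      then have "p \<in> \<Union>F" by (rule subsetD[OF F(3)])
      then show ?thesis unfolding Union_Un_distrib by (rule UnI1)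
    qed
  qed
  moreover have "finite (F \<union> h ` J0)" "F \<union> h ` J0 \<subseteq> \<U>" using F J0 h by auto
  ultimately show "\<exists>\<F>. finite \<F> \<and> \<F> \<subseteq> \<U> \<and> topspace T \<subseteq> \<Union>\<F>"
    by (intro exI[of _ "F \<union> h ` J0"] conjI)
qed

section \<open>The embedding of the graph with its ends\<close>

abbreviation \<iota> where "\<iota> \<equiv> induced_inclusion G \<alpha>"

lemma incl_Inl [simp]: "\<iota> (Inl p) = Inl p"
  by (simp add: induced_inclusion_def)

lemma incl_Inr: "\<iota> (Inr \<omega>) = Inr (\<lambda>X\<in>fin_sets G. \<alpha> X (end_comp G X \<omega>))"
  by (simp add: induced_inclusion_def)

lemma end_in_lim:
  assumes "\<omega> \<in> ends G"
  shows "(\<lambda>X\<in>fin_sets G. \<alpha> X (end_comp G X \<omega>)) \<in> lim"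
  unfolding inverse_limit_def
  using emb_in end_comp(1)[OF assms] bond(2) comp_map_end_comp[OF assms] by auto

lemma VG_subbase:
  "VG G = topology_generated_by ({Inl ` W | W. openin (complex_topology G) W} \<union>
      {Inl ` comp_points G X (end_comp G X \<omega>) \<union> Inr ` ends_at G X \<omega> | X \<omega>.
         X \<in> fin_sets G \<and> \<omega> \<in> ends G})"
  unfolding VG_def comp_points_def ..

lemma openin_VG_Inl: "openin (complex_topology G) W \<Longrightarrow> openin (VG G) (Inl ` W)"
  unfolding VG_subbase by (rule topology_generated_by_Basis) blast

lemma openin_VG_end: "X \<in> fin_sets G \<Longrightarrow> \<omega> \<in> ends G \<Longrightarrow>
    openin (VG G) (Inl ` comp_points G X (end_comp G X \<omega>) \<union> Inr ` ends_at G X \<omega>)"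
  unfolding VG_subbase by (rule topology_generated_by_Basis) blast

lemma topspace_VG: "topspace (VG G) = Inl ` topspace (complex_topology G) \<union> Inr ` ends G"
proof
  show "topspace (VG G) \<subseteq> Inl ` topspace (complex_topology G) \<union> Inr ` ends G"
  proof
    fix p assume "p \<in> topspace (VG G)"
    then consider W where "openin (complex_topology G) W" "p \<in> Inl ` W"
      | X \<omega> where "X \<in> fin_sets G" "\<omega> \<in> ends G"
          "p \<in> Inl ` comp_points G X (end_comp G X \<omega>) \<union> Inr ` ends_at G X \<omega>"
      unfolding VG_subbase topology_generated_by_topspace by blast
    then show "p \<in> Inl ` topspace (complex_topology G) \<union> Inr ` ends G"
    proof cases
      case 1
      then show ?thesis using openin_subset by blast
    next
      case 2
      then show ?thesis using comp_points_subset[OF end_comp(1)[OF 2(2,1)]] by (auto simp: ends_at_def)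
    qed
  qed
  have "Inr \<omega> \<in> topspace (VG G)" if "\<omega> \<in> ends G" for \<omega>
    using openin_subset[OF openin_VG_end[OF empty_fin that]] that by (auto simp: ends_at_def)
  then show "Inl ` topspace (complex_topology G) \<union> Inr ` ends G \<subseteq> topspace (VG G)"
    using openin_subset[OF openin_VG_Inl[OF openin_topspace]] by auto
qed

lemma incl_image: "\<iota> ` topspace (VG G) \<subseteq> topspace T"
  using end_in_lim by (auto simp: topspace_VG topspace_T incl_Inr)

text \<open>Ends with equal threads have the same component at each level, since each
  \<open>\<alpha> X\<close> is injective, and are then equal by \<open>ends_eqI\<close>.\<close>

lemma inj_incl: "inj_on \<iota> (topspace (VG G))"
proof (rule inj_onI)
  fix p q assume p: "p \<in> topspace (VG G)" and q: "q \<in> topspace (VG G)" and eq: "\<iota> p = \<iota> q"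
  show "p = q"
  proof (cases p)
    case (Inl a)
    then show ?thesis using eq by (cases q) (auto simp: incl_Inr)
  next
    case (Inr \<omega>)
    then obtain \<omega>' where q': "q = Inr \<omega>'" using eq by (cases q) (auto simp: incl_Inr)
    have ends: "\<omega> \<in> ends G" "\<omega>' \<in> ends G" using p q Inr q' by (auto simp: topspace_VG)
    have "end_comp G X \<omega> = end_comp G X \<omega>'" if X: "X \<in> fin_sets G" for X
    proof -
      have "(\<lambda>X\<in>fin_sets G. \<alpha> X (end_comp G X \<omega>)) = (\<lambda>X\<in>fin_sets G. \<alpha> X (end_comp G X \<omega>'))"
        using eq unfolding Inr q' incl_Inr by (rule sum.inject(2)[THEN iffD1])
      from fun_cong[OF this, of X] have "\<alpha> X (end_comp G X \<omega>) = \<alpha> X (end_comp G X \<omega>')"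
        using X by simp
      then show ?thesis
        using inj_onD[OF emb_inj[OF X]] end_comp(1)[OF _ X] ends by blast
    qed
    then show ?thesis using ends_eqI[OF ends] Inr q' by simp
  qed
qed

lemma incl_Inr_in_N:
  "\<omega> \<in> ends G \<Longrightarrow> X \<in> fin_sets G \<Longrightarrow> \<iota> (Inr \<omega>) \<in> N X Q \<longleftrightarrow> \<alpha> X (end_comp G X \<omega>) \<in> Q"
  using end_in_lim by (auto simp: incl_Inr Inr_in_N)

lemma continuous_incl: "continuous_map (VG G) T \<iota>"
  unfolding induced_space_def
proof (rule continuous_on_generated_topo)
  show "\<iota> ` topspace (VG G) \<subseteq> \<Union>({Inl ` W |W. openin (complex_topology G) W} \<union>
      {N X Q |X Q. X \<in> fin_sets G \<and> openin (A X) Q})"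
    using incl_image unfolding induced_space_def topology_generated_by_topspace .
next
  fix U assume "U \<in> {Inl ` W |W. openin (complex_topology G) W} \<union>
      {N X Q |X Q. X \<in> fin_sets G \<and> openin (A X) Q}"
  then consider W where "U = Inl ` W" "openin (complex_topology G) W"
    | X Q where "U = N X Q" "X \<in> fin_sets G" by blast
  then show "openin (VG G) (\<iota> -` U \<inter> topspace (VG G))"
  proof cases
    case (1 W)
    have "p \<in> \<iota> -` U \<inter> topspace (VG G) \<longleftrightarrow> p \<in> Inl ` W" for p
      using openin_subset[OF 1(2)] by (cases p) (auto simp: 1(1) incl_Inr topspace_VG)
    then have "\<iota> -` U \<inter> topspace (VG G) = Inl ` W" by blast
    then show ?thesis using openin_VG_Inl 1(2) by simp
  next
    case (2 X Q)
    \<comment> \<open>The preimage is a graph part plus the union of the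
      \<open>VG\<close>-neighbourhoods of all ends whose component is sent into \<open>Q\<close>;
      these add no graph points outside \<open>?W\<close>.\<close>
    let ?B = "\<lambda>\<omega>. Inl ` comp_points G X (end_comp G X \<omega>) \<union> Inr ` ends_at G X \<omega>"
    let ?S = "{\<omega> \<in> ends G. \<alpha> X (end_comp G X \<omega>) \<in> Q}"
    let ?W = "Inl -` N X Q :: 'v point set"
    have eq: "p \<in> \<iota> -` U \<inter> topspace (VG G) \<longleftrightarrow> p \<in> Inl ` ?W \<union> \<Union>(?B ` ?S)" for p
    proof (cases p)
      case (Inl q)
      have "q \<in> comp_points G X (end_comp G X \<omega>) \<Longrightarrow> \<omega> \<in> ?S \<Longrightarrow> Inl q \<in> N X Q" for \<omega>
        using end_comp(1)[OF _ 2(2), of \<omega>] by (auto simp: Inl_in_N)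
      moreover have "Inl q \<in> N X Q \<Longrightarrow> Inl q \<in> topspace (VG G)"
        using openin_subset[OF N_vimage_Inl[of X Q]] by (auto simp: topspace_VG)
      ultimately show ?thesis unfolding Inl 2(1) by auto
    next
      case (Inr \<omega>)
      have "Inr \<omega> \<in> \<iota> -` N X Q \<inter> topspace (VG G) \<longleftrightarrow> \<omega> \<in> ?S"
        using incl_Inr_in_N[OF _ 2(2)] by (auto simp: topspace_VG)
      also have "\<dots> \<longleftrightarrow> (\<exists>\<omega>'\<in>?S. \<omega> \<in> ends_at G X \<omega>')" by (auto simp: ends_at_def)
      finally show ?thesis unfolding Inr 2(1) by auto
    qed
    have "\<iota> -` U \<inter> topspace (VG G) = Inl ` ?W \<union> \<Union>(?B ` ?S)" using eq by (rule set_eqI)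
    moreover have "openin (VG G) (Inl ` ?W \<union> \<Union>(?B ` ?S))"
      using openin_VG_Inl[OF N_vimage_Inl] openin_VG_end[OF 2(2)]
      by (intro openin_Un openin_Union) auto
    ultimately show ?thesis by simp
  qed
qed

text \<open>Injectivity of \<open>\<alpha> X\<close> lets the singleton select exactly the component
  of the end. As the singleton is open by \<open>emb_isolated\<close>, this makes the inclusion open
  onto its image.\<close>

lemma incl_image_end_nbhd:
  assumes X: "X \<in> fin_sets G" and \<omega>: "\<omega> \<in> ends G"
  shows "\<iota> ` (Inl ` comp_points G X (end_comp G X \<omega>) \<union> Inr ` ends_at G X \<omega>)
       = N X {\<alpha> X (end_comp G X \<omega>)} \<inter> \<iota> ` topspace (VG G)" (is "\<iota> ` ?B = ?N \<inter> _")
proof -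
  note C = end_comp(1)[OF \<omega> X]
  have mem: "\<iota> p \<in> ?N \<longleftrightarrow> p \<in> ?B" if p: "p \<in> topspace (VG G)" for p
  proof (cases p)
    case (Inl q)
    have "\<alpha> X D = \<alpha> X (end_comp G X \<omega>) \<longleftrightarrow> D = end_comp G X \<omega>" if "D \<in> comps G X" for D
      using inj_onD[OF emb_inj[OF X]] that C by blast
    then show ?thesis using Inl C by (auto simp: Inl_in_N)
  next
    case (Inr \<omega>')
    then have \<omega>': "\<omega>' \<in> ends G" using p by (auto simp: topspace_VG)
    have "\<alpha> X (end_comp G X \<omega>') = \<alpha> X (end_comp G X \<omega>) \<longleftrightarrow> end_comp G X \<omega>' = end_comp G X \<omega>"
      using inj_on_eq_iff[OF emb_inj[OF X] end_comp(1)[OF \<omega>' X] C] .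
    then show ?thesis using Inr \<omega>' incl_Inr_in_N[OF \<omega>' X] by (auto simp: ends_at_def)
  qed
  have sub: "?B \<subseteq> topspace (VG G)" using openin_subset[OF openin_VG_end[OF X \<omega>]] .
  show ?thesis
  proof (intro equalityI subsetI)
    fix z assume "z \<in> \<iota> ` ?B"
    then obtain p where "p \<in> ?B" "z = \<iota> p" by (elim imageE)
    then show "z \<in> ?N \<inter> \<iota> ` topspace (VG G)" using mem subsetD[OF sub] by simp
  next
    fix z assume "z \<in> ?N \<inter> \<iota> ` topspace (VG G)"
    then obtain p where "p \<in> topspace (VG G)" "z = \<iota> p" "z \<in> ?N" by (elim IntE imageE)
    then show "z \<in> \<iota> ` ?B" using mem by (intro image_eqI) simp_all
  qed
qed

lemma embedding_incl: "embedding_map (VG G) T \<iota>"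
proof -
  let ?S = "subtopology T (\<iota> ` topspace (VG G))"
  have cont: "continuous_map (VG G) ?S \<iota>"
    using continuous_incl by (auto simp: continuous_map_in_subtopology)
  have "openin ?S (\<iota> ` U)" if "openin (VG G) U" for U
  proof -
    have "generate_topology_on ({Inl ` W | W. openin (complex_topology G) W} \<union>
      {Inl ` comp_points G X (end_comp G X \<omega>) \<union> Inr ` ends_at G X \<omega> | X \<omega>.
         X \<in> fin_sets G \<and> \<omega> \<in> ends G}) U"
      using openin_topology_generated_by that unfolding VG_subbase by blast
    then show ?thesis
    proof (induction rule: generate_topology_on.induct)
      case (Int a b)
      have "a \<subseteq> topspace (VG G)" "b \<subseteq> topspace (VG G)"
        using Int.hyps openin_topology_generated_by_iff openin_subset unfolding VG_subbase by blast+
      \<comment> \<open>Injectivity makes images commute with finite intersections, so that openness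
        of the map can be checked on the subbasis.\<close>
      then have "\<iota> ` (a \<inter> b) = \<iota> ` a \<inter> \<iota> ` b" using inj_on_image_Int[OF inj_incl] by blast
      then show ?case using Int.IH by (simp add: openin_Int)
    next
      case (UN K)
      then show ?case by (auto simp: image_Union intro!: openin_Union)
    next
      case (Basis s)
      then consider W where "s = Inl ` W" "openin (complex_topology G) W"
        | X \<omega> where "s = Inl ` comp_points G X (end_comp G X \<omega>) \<union> Inr ` ends_at G X \<omega>"
            "X \<in> fin_sets G" "\<omega> \<in> ends G" by blast
      then show ?case
      proof cases
        case (1 W)
        have "\<iota> ` s = Inl ` W" by (auto simp: 1(1) image_image)
        moreover have "\<iota> ` s \<subseteq> \<iota> ` topspace (VG G)"
          using openin_subset[OF openin_VG_Inl[OF 1(2)]] 1(1) by blast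
        ultimately show ?thesis
          using openin_Inl[OF 1(2)] unfolding openin_subtopology by (metis inf.absorb_iff1)
      next
        case (2 X \<omega>)
        then show ?thesis
          using incl_image_end_nbhd[OF 2(2,3)] openin_N[OF 2(2) emb_isolated[OF 2(2) end_comp(1)[OF 2(3,2)]]]
          unfolding openin_subtopology by metis
      qed
    qed auto
  qed
  then have "open_map (VG G) ?S \<iota>" by (simp add: open_map_def)
  then have "embedding_map (VG G) ?S \<iota>"
    using cont inj_incl by (intro injective_open_imp_embedding_map)
  then show ?thesis by (simp add: embedding_map_in_subtopology)
qed

lemma dense_incl: "T closure_of (\<iota> ` topspace (VG G)) = topspace T"
  unfolding dense_intersects_open
proof (intro allI impI)
  fix U assume U: "openin T U \<and> U \<noteq> {}"
  then obtain p where p: "p \<in> U" "p \<in> topspace T" using openin_subset by blast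
  show "\<iota> ` topspace (VG G) \<inter> U \<noteq> {}"
  proof (cases p)
    case (Inl q)
    then have "\<iota> (Inl q) \<in> U" "Inl q \<in> topspace (VG G)"
      using p by (auto simp: topspace_T topspace_VG)
    then show ?thesis by blast
  next
    case (Inr x)
    then obtain X Q where XQ: "X \<in> fin_sets G" "openin (A X) Q" "Inr x \<in> N X Q" "N X Q \<subseteq> U"
      using limit_base[of U x] U p by blast
    then have "Q \<noteq> {}" by (auto simp: Inr_in_N)
    then obtain C where C: "C \<in> comps G X" "\<alpha> X C \<in> Q" using emb_dense XQ by blast
    obtain v where v: "v \<in> C" using comps_nonempty[OF C(1)] by blast
    then have "v \<in> verts G" using comps_subset[OF C(1)] by blast
    moreover have "Inl (Vertex v) \<in> N X Q" using C v by (auto simp: Inl_in_N)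
    ultimately have "\<iota> (Inl (Vertex v)) \<in> U" "Inl (Vertex v) \<in> topspace (VG G)"
      using XQ(4) by (auto simp: topspace_VG topspace_complex)
    then show ?thesis by blast
  qed
qed

text \<open>Neighbourhoods need to be disjoint only on vertices and limit points; overlaps in inner
  edge points, which can occur between a vertex and a limit point, are harmless.\<close>

lemma Hausdorff_T:
  "Hausdorff_space (subtopology T (topspace T - \<iota> ` Inl ` inner_points G))"
proof -
  let ?S = "topspace T - \<iota> ` Inl ` inner_points G"
  have S: "p \<in> ?S \<longleftrightarrow> p \<in> Inl ` Vertex ` verts G \<union> Inr ` lim" for p
    by (cases p) (auto simp: topspace_T topspace_complex image_image inner_points_def)
  \<comment> \<open>The last assumption leaves out a limit point followed by a vertex; that order is
    recovered by symmetry in \<open>sep'\<close>.\<close>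
  have sep: "\<exists>U V. openin T U \<and> openin T V \<and> p \<in> U \<and> q \<in> V \<and> U \<inter> V \<inter> ?S = {}"
    if p: "p \<in> ?S" and q: "q \<in> ?S" and ne: "p \<noteq> q"
      and V: "p \<in> Inl ` Vertex ` verts G \<or> q \<notin> Inl ` Vertex ` verts G" for p q
  proof -
    consider u v where "p = Inl (Vertex u)" "u \<in> verts G" "q = Inl (Vertex v)" "v \<in> verts G"
      | u y where "p = Inl (Vertex u)" "u \<in> verts G" "q = Inr y" "y \<in> lim"
      | x y where "p = Inr x" "x \<in> lim" "q = Inr y" "y \<in> lim"
      using p q V unfolding S by blast
    then show ?thesis
    proof cases
      case (1 u v)
      let ?U = "\<lambda>u. Inl ` vertex_nbhd G u (\<lambda>_. 1/2)"
      have "openin T (?U u)" "openin T (?U v)"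
        using 1 by (auto intro!: openin_Inl openin_complex_vertex_nbhd)
      moreover have "p \<in> ?U u" "q \<in> ?U v" "?U u \<inter> ?U v \<inter> ?S = {}"
        using 1 ne unfolding set_eq_iff Int_iff S by (auto simp: vertex_nbhd_def)
      ultimately show ?thesis by blast
    next
      case (2 u y)
      \<comment> \<open>Level \<open>{u}\<close> suffices: \<open>u\<close> lies in no component of
        \<open>G - {u}\<close>.\<close>
      let ?U = "Inl ` vertex_nbhd G u (\<lambda>_. 1/2)" and ?V = "N {u} (topspace (A {u}))"
      have u: "{u} \<in> fin_sets G" using 2 by (simp add: fin_sets_def)
      have "openin T ?U" "openin T ?V"
        using 2 u by (auto intro!: openin_Inl openin_complex_vertex_nbhd openin_N)
      moreover have "p \<in> ?U" "q \<in> ?V"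
        using 2 lim_in[OF _ u] by (auto simp: vertex_nbhd_def Inr_in_N)
      moreover have "?U \<inter> ?V \<inter> ?S = {}"
        unfolding set_eq_iff Int_iff S using comps_subset[of _ G "{u}"]
        by (fastforce simp: vertex_nbhd_def Inl_in_N)
      ultimately show ?thesis by blast
    next
      case (3 x y)
      then obtain X where X: "X \<in> fin_sets G" "x X \<noteq> y X" using lim_eqI[of x y] ne by blast
      then obtain Q R where QR: "openin (A X) Q" "openin (A X) R" "x X \<in> Q" "y X \<in> R" "disjnt Q R"
        using level(2)[OF X(1)] lim_in 3 unfolding Hausdorff_space_def by metis
      have "openin T (N X Q)" "openin T (N X R)" using QR X openin_N by auto
      moreover have "p \<in> N X Q" "q \<in> N X R" using 3 QR by (auto simp: Inr_in_N)
      moreover have "N X Q \<inter> N X R \<inter> ?S = {}"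
      proof -
        \<comment> \<open>A common vertex would lie in a single component, whose image would belong
          to both \<open>Q\<close> and \<open>R\<close>.\<close>
        have False if r: "r \<in> N X Q" "r \<in> N X R" "r \<in> ?S" for r
        proof (cases r)
          case (Inl a)
          then obtain v where "r = Inl (Vertex v)" using r(3) unfolding S by blast
          then obtain C D where "C \<in> comps G X" "\<alpha> X C \<in> Q" "v \<in> C" "D \<in> comps G X" "\<alpha> X D \<in> R" "v \<in> D"
            using r(1,2) by (auto simp: Inl_in_N)
          then show False using comps_eq[of C G X D v] QR(5) by (auto simp: disjnt_def)
        next
          case (Inr z)
          show False using r(1,2) Inr QR(5) by (auto simp: Inr_in_N disjnt_def)
        qed
        then show ?thesis by blast
      qed
      ultimately show ?thesis by blast
    qed
  qed
  have sep': "\<exists>U V. openin T U \<and> openin T V \<and> p \<in> U \<and> q \<in> V \<and> U \<inter> V \<inter> ?S = {}"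
    if "p \<in> ?S" "q \<in> ?S" "p \<noteq> q" for p q
  proof (cases "p \<in> Inl ` Vertex ` verts G \<or> q \<notin> Inl ` Vertex ` verts G")
    case True
    then show ?thesis using sep[of p q] that by blast
  next
    case False
    then have "q \<in> Inl ` Vertex ` verts G \<or> p \<notin> Inl ` Vertex ` verts G" by simp
    from sep[OF that(2,1) that(3)[symmetric] this]
    obtain U V where "openin T U \<and> openin T V \<and> q \<in> U \<and> p \<in> V \<and> U \<inter> V \<inter> ?S = {}"
      by (elim exE)
    then show ?thesis by (intro exI[of _ V] exI[of _ U]) (simp add: Int_commute)
  qed
  show ?thesis
    unfolding Hausdorff_space_def
  proof (intro allI impI)
    fix p q assume "p \<in> topspace (subtopology T ?S) \<and> q \<in> topspace (subtopology T ?S) \<and> p \<noteq> q"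
    then have pq: "p \<in> ?S" "q \<in> ?S" "p \<noteq> q" by auto
    then obtain U V where UV: "openin T U" "openin T V" "p \<in> U" "q \<in> V" "U \<inter> V \<inter> ?S = {}"
      using sep'[OF pq] by blast
    have "openin (subtopology T ?S) (U \<inter> ?S)" "openin (subtopology T ?S) (V \<inter> ?S)"
      using UV by (auto simp: openin_subtopology)
    moreover have "p \<in> U \<inter> ?S" "q \<in> V \<inter> ?S" "disjnt (U \<inter> ?S) (V \<inter> ?S)"
      using UV pq by (auto simp: disjnt_def)
    ultimately show "\<exists>U V. openin (subtopology T ?S) U \<and> openin (subtopology T ?S) V \<and> p \<in> U \<and> q \<in> V \<and> disjnt U V"
      by (intro exI[of _ "U \<inter> ?S"] exI[of _ "V \<inter> ?S"] conjI)
  qed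
qed

theorem Omega_compactification_induced: "Omega_compactification G T \<iota>"
  unfolding Omega_compactification_def
  using compact_T embedding_incl dense_incl Hausdorff_T by blast

end

section \<open>Spaces of filters\<close>

text \<open>The common framework for both level spaces: \<open>ultrafilter_on\<close> adds the
  dichotomy for complements, which the cofinite filters at critical sets lack.\<close>

definition proper_filter :: "'c set \<Rightarrow> 'c set set \<Rightarrow> bool" where
  "proper_filter S F \<longleftrightarrow>
     F \<subseteq> Pow S \<and> S \<in> F \<and> {} \<notin> F \<and> (\<forall>P\<in>F. \<forall>Q\<in>F. P \<inter> Q \<in> F) \<and>
     (\<forall>P\<in>F. \<forall>Q. P \<subseteq> Q \<longrightarrow> Q \<subseteq> S \<longrightarrow> Q \<in> F)"

lemma proper_filterD:
  assumes "proper_filter S F"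
  shows "P \<in> F \<Longrightarrow> P \<subseteq> S" "S \<in> F" "{} \<notin> F" "P \<in> F \<Longrightarrow> Q \<in> F \<Longrightarrow> P \<inter> Q \<in> F"
    "P \<in> F \<Longrightarrow> P \<subseteq> Q \<Longrightarrow> Q \<subseteq> S \<Longrightarrow> Q \<in> F"
  using assms unfolding proper_filter_def by blast+

lemma ultrafilter_on_iff:
  "ultrafilter_on S U \<longleftrightarrow> proper_filter S U \<and> (\<forall>P. P \<subseteq> S \<longrightarrow> P \<in> U \<or> S - P \<in> U)"
  unfolding ultrafilter_on_def proper_filter_def by argo

lemma ultrafilter_onD:
  assumes "ultrafilter_on S U"
  shows "proper_filter S U" "P \<subseteq> S \<Longrightarrow> P \<notin> U \<Longrightarrow> S - P \<in> U"
  using assms unfolding ultrafilter_on_iff by auto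

definition principal :: "'c set \<Rightarrow> 'c \<Rightarrow> 'c set set" where
  "principal S c = {P. P \<subseteq> S \<and> c \<in> P}"

lemma proper_filter_principal: "c \<in> S \<Longrightarrow> proper_filter S (principal S c)"
  by (auto simp: proper_filter_def principal_def)

lemma principal_uf_eq: "principal_uf G X = principal (comps G X)"
  by (simp add: fun_eq_iff principal_uf_def principal_def)

text \<open>Every member meets \<open>{c}\<close>, since the intersection is again a member and so
  nonempty. This makes principal filters isolated points.\<close>

lemma principal_eqI:
  assumes F: "proper_filter S F" and c: "{c} \<in> F"
  shows "F = principal S c"
proof (intro set_eqI iffI)
  fix P assume P: "P \<in> F"
  then have "P \<inter> {c} \<noteq> {}" using proper_filterD(3,4)[OF F] c by metis
  then show "P \<in> principal S c" using proper_filterD(1)[OF F P] by (auto simp: principal_def)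
next
  fix P assume "P \<in> principal S c"
  then show "P \<in> F" using proper_filterD(5)[OF F c] by (auto simp: principal_def)
qed

lemma openin_stone: "P \<subseteq> S \<Longrightarrow> openin (stone_topology S \<F>) {F \<in> \<F>. P \<in> F}"
  unfolding stone_topology_def by (rule topology_generated_by_Basis) blast

lemma topspace_stone:
  assumes "\<And>F. F \<in> \<F> \<Longrightarrow> proper_filter S F"
  shows "topspace (stone_topology S \<F>) = \<F>"
  unfolding stone_topology_def topology_generated_by_topspace
  using proper_filterD(2)[OF assms] by blast

text \<open>Filters are closed under intersections and supersets, so \<open>P\<close> and
  \<open>Q\<close> both belong to a filter exactly when \<open>P \<inter> Q\<close> does; the
  subbasis is therefore a base.\<close>

lemma stone_base:
  assumes filter: "\<And>F. F \<in> \<F> \<Longrightarrow> proper_filter S F"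
    and U: "openin (stone_topology S \<F>) U" "F \<in> U"
  shows "F \<in> \<F> \<and> (\<exists>P\<in>F. {F' \<in> \<F>. P \<in> F'} \<subseteq> U)"
proof -
  have "generate_topology_on {{F \<in> \<F>. P \<in> F} | P. P \<subseteq> S} U"
    using openin_topology_generated_by U(1) unfolding stone_topology_def by blast
  then show ?thesis using U(2)
  proof (induction rule: generate_topology_on.induct)
    case (Int a b)
    then obtain P Q where F: "F \<in> \<F>" and P: "P \<in> F" "{F' \<in> \<F>. P \<in> F'} \<subseteq> a"
      and Q: "Q \<in> F" "{F' \<in> \<F>. Q \<in> F'} \<subseteq> b" by blast
    note filter_F = filter[OF F]
    have "P \<in> F' \<and> Q \<in> F'" if "F' \<in> \<F>" "P \<inter> Q \<in> F'" for F'
      using proper_filterD(5)[OF filter[OF that(1)] that(2)] proper_filterD(1)[OF filter_F] P Q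
      by blast
    then have "{F' \<in> \<F>. P \<inter> Q \<in> F'} \<subseteq> a \<inter> b" using P Q by blast
    moreover have "P \<inter> Q \<in> F" using proper_filterD(4)[OF filter_F] P Q by blast
    ultimately show ?case using F by blast
  next
    case (UN K)
    then obtain k where "k \<in> K" "F \<in> k" by blast
    with UN.IH[of k] show ?case by blast
  next
    case (Basis s)
    then show ?case by blast
  qed simp
qed

text \<open>Open covers may be refined to basic ones, which turns compactness into a purely
  combinatorial condition on families of subsets of \<open>S\<close>.\<close>

lemma compact_space_stone:
  assumes filter: "\<And>F. F \<in> \<F> \<Longrightarrow> proper_filter S F"
    and fin: "\<And>\<P>. \<P> \<subseteq> Pow S \<Longrightarrow> \<forall>F\<in>\<F>. \<exists>P\<in>\<P>. P \<in> F \<Longrightarrow>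
                \<exists>\<P>0. finite \<P>0 \<and> \<P>0 \<subseteq> \<P> \<and> (\<forall>F\<in>\<F>. \<exists>P\<in>\<P>0. P \<in> F)"
  shows "compact_space (stone_topology S \<F>)"
proof -
  have top: "topspace (stone_topology S \<F>) = \<F>" using filter by (rule topspace_stone)
  show ?thesis
    unfolding compact_space_alt top
  proof (intro allI impI)
    fix \<U> assume \<U>: "(\<forall>U\<in>\<U>. openin (stone_topology S \<F>) U) \<and> \<F> \<subseteq> \<Union>\<U>"
    define \<P> where "\<P> = {P. P \<subseteq> S \<and> (\<exists>U\<in>\<U>. {F \<in> \<F>. P \<in> F} \<subseteq> U)}"
    have "\<forall>F\<in>\<F>. \<exists>P\<in>\<P>. P \<in> F"
    proof
      fix F assume F: "F \<in> \<F>"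
      then obtain U where U: "U \<in> \<U>" "F \<in> U" using \<U> by blast
      obtain P where "P \<in> F" "{F \<in> \<F>. P \<in> F} \<subseteq> U"
        using stone_base[of \<F> S U F] filter U \<U> by blast
      then show "\<exists>P\<in>\<P>. P \<in> F" using U(1) proper_filterD(1)[OF filter[OF F]] by (auto simp: \<P>_def)
    qed
    moreover have "\<P> \<subseteq> Pow S" by (auto simp: \<P>_def)
    ultimately obtain \<P>0 where \<P>0: "finite \<P>0" "\<P>0 \<subseteq> \<P>" "\<forall>F\<in>\<F>. \<exists>P\<in>\<P>0. P \<in> F"
      using fin[of \<P>] by blast
    have "\<forall>P\<in>\<P>. \<exists>U\<in>\<U>. {F \<in> \<F>. P \<in> F} \<subseteq> U" by (auto simp: \<P>_def)
    then obtain u where u: "\<And>P. P \<in> \<P> \<Longrightarrow> u P \<in> \<U> \<and> {F \<in> \<F>. P \<in> F} \<subseteq> u P" by metis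
    have "\<F> \<subseteq> \<Union>(u ` \<P>0)" using \<P>0(2,3) u by blast
    moreover have "finite (u ` \<P>0)" "u ` \<P>0 \<subseteq> \<U>" using \<P>0 u by auto
    ultimately show "\<exists>\<V>. finite \<V> \<and> \<V> \<subseteq> \<U> \<and> \<F> \<subseteq> \<Union>\<V>" by blast
  qed
qed

text \<open>Disjoint members of two filters give disjoint open sets, and
  \<open>principal_eqI\<close> isolates the principal filters. Density holds because any element of
  a member \<open>P\<close> yields a principal filter containing \<open>P\<close>.\<close>

lemma Hausdorff_compactification_stone:
  assumes filter: "\<And>F. F \<in> \<F> \<Longrightarrow> proper_filter S F"
    and prin: "\<And>c. c \<in> S \<Longrightarrow> principal S c \<in> \<F>"
    and sep: "\<And>F F'. F \<in> \<F> \<Longrightarrow> F' \<in> \<F> \<Longrightarrow> F \<noteq> F' \<Longrightarrow> \<exists>P\<in>F. \<exists>Q\<in>F'. P \<inter> Q = {}"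
    and comp: "compact_space (stone_topology S \<F>)"
  shows "Hausdorff_compactification (discrete_topology S) (stone_topology S \<F>) (principal S)"
  unfolding Hausdorff_compactification_def
proof (intro conjI comp)
  let ?T = "stone_topology S \<F>"
  have top: "topspace ?T = \<F>" using filter by (rule topspace_stone)
  show "Hausdorff_space ?T"
    unfolding Hausdorff_space_def top
  proof (intro allI impI)
    fix F F' assume FF': "F \<in> \<F> \<and> F' \<in> \<F> \<and> F \<noteq> F'"
    then obtain P Q where PQ: "P \<in> F" "Q \<in> F'" "P \<inter> Q = {}" using sep by blast
    have "P \<subseteq> S" "Q \<subseteq> S" using PQ FF' proper_filterD(1)[OF filter] by blast+
    then have "openin ?T {F \<in> \<F>. P \<in> F}" "openin ?T {F \<in> \<F>. Q \<in> F}" by (simp_all add: openin_stone)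
    moreover have "disjnt {F \<in> \<F>. P \<in> F} {F \<in> \<F>. Q \<in> F}"
    proof -
      have False if "H \<in> \<F>" "P \<in> H" "Q \<in> H" for H
        using proper_filterD(3,4)[OF filter[OF that(1)]] that PQ(3) by metis
      then show ?thesis by (auto simp: disjnt_def)
    qed
    moreover have "F \<in> {F \<in> \<F>. P \<in> F}" "F' \<in> {F \<in> \<F>. Q \<in> F}" using FF' PQ by auto
    ultimately show "\<exists>U V. openin ?T U \<and> openin ?T V \<and> F \<in> U \<and> F' \<in> V \<and> disjnt U V" by blast
  qed
  have isolated: "openin ?T {principal S c}" if c: "c \<in> S" for c
  proof -
    have "{F \<in> \<F>. {c} \<in> F} = {principal S c}"
    proof (intro equalityI subsetI)
      fix F assume "F \<in> {F \<in> \<F>. {c} \<in> F}"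
      then show "F \<in> {principal S c}" using principal_eqI[OF filter, of F c] by simp
    next
      fix F assume "F \<in> {principal S c}"
      then show "F \<in> {F \<in> \<F>. {c} \<in> F}" using prin[OF c] c by (simp add: principal_def)
    qed
    then show ?thesis using openin_stone[of "{c}" S \<F>] c by simp
  qed
  show "embedding_map (discrete_topology S) ?T (principal S)"
  proof (rule injective_open_imp_embedding_map)
    show "continuous_map (discrete_topology S) ?T (principal S)"
      using prin by (auto simp: top)
    show "open_map (discrete_topology S) ?T (principal S)"
      unfolding open_map_def
    proof (intro allI impI)
      fix U assume "openin (discrete_topology S) U"
      then have "openin ?T (\<Union>c\<in>U. {principal S c})" using isolated by (intro openin_Union) auto
      then show "openin ?T (principal S ` U)" by (simp add: UNION_singleton_eq_range)
    qed
    show "inj_on (principal S) (topspace (discrete_topology S))"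
    proof (rule inj_onI)
      fix c d assume c: "c \<in> topspace (discrete_topology S)" and eq: "principal S c = principal S d"
      have "{c} \<in> principal S c" using c by (simp add: principal_def)
      then have "{c} \<in> principal S d" unfolding eq .
      then show "c = d" by (simp add: principal_def)
    qed
  qed
  show "?T closure_of (principal S ` topspace (discrete_topology S)) = topspace ?T"
    unfolding dense_intersects_open
  proof (intro allI impI)
    fix U assume U: "openin ?T U \<and> U \<noteq> {}"
    then obtain F where "F \<in> U" by blast
    then obtain P where P: "F \<in> \<F>" "P \<in> F" "{F' \<in> \<F>. P \<in> F'} \<subseteq> U"
      using stone_base[of \<F> S U F] filter U by blast
    have "P \<noteq> {}" "P \<subseteq> S" using proper_filterD(1,3)[OF filter[OF P(1)]] P(2) by blast+
    then obtain c where c: "c \<in> P" "c \<in> S" by blast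
    have "principal S c \<in> U" using P(3) prin[OF c(2)] c \<open>P \<subseteq> S\<close> by (auto simp: principal_def)
    then show "principal S ` topspace (discrete_topology S) \<inter> U \<noteq> {}" using c by auto
  qed
qed

text \<open>Zorn's lemma for families with the finite intersection property. The factor
  \<open>S\<close> covers the empty subfamily, whose intersection would otherwise be the whole
  type.\<close>

lemma ultrafilter_extension:
  assumes B: "B \<subseteq> Pow S" and fip: "\<And>B0. finite B0 \<Longrightarrow> B0 \<subseteq> B \<Longrightarrow> S \<inter> \<Inter>B0 \<noteq> {}"
  shows "\<exists>U. ultrafilter_on S U \<and> B \<subseteq> U"
proof -
  define \<A> where "\<A> = {M. B \<subseteq> M \<and> M \<subseteq> Pow S \<and> (\<forall>B0. finite B0 \<longrightarrow> B0 \<subseteq> M \<longrightarrow> S \<inter> \<Inter>B0 \<noteq> {})}"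
  have \<A>D: "B \<subseteq> M" "M \<subseteq> Pow S" "\<And>B0. finite B0 \<Longrightarrow> B0 \<subseteq> M \<Longrightarrow> S \<inter> \<Inter>B0 \<noteq> {}" if "M \<in> \<A>" for M
    using that by (simp_all add: \<A>_def)
  have "\<exists>M\<in>\<A>. \<forall>X\<in>\<A>. M \<subseteq> X \<longrightarrow> X = M"
  proof (rule subset_Zorn_nonempty)
    have "B \<in> \<A>" using assms by (auto simp: \<A>_def)
    then show "\<A> \<noteq> {}" by blast
    fix \<C> assume \<C>: "\<C> \<noteq> {}" "subset.chain \<A> \<C>"
    then have sub: "\<C> \<subseteq> \<A>" by (auto simp: subset.chain_def)
    have "S \<inter> \<Inter>B0 \<noteq> {}" if B0: "finite B0" "B0 \<subseteq> \<Union>\<C>" for B0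
    proof -
      obtain M where M: "M \<in> \<C>" "B0 \<subseteq> M"
        using finite_subset_Union_chain[OF B0 \<C>] by blast
      show ?thesis using \<A>D(3)[OF subsetD[OF sub M(1)] B0(1) M(2)] .
    qed
    moreover have "B \<subseteq> \<Union>\<C>"
    proof -
      obtain M where "M \<in> \<C>" using \<C>(1) by blast
      then show ?thesis using \<A>D(1)[of M] sub by blast
    qed
    moreover have "\<Union>\<C> \<subseteq> Pow S" using \<A>D(2)[OF subsetD[OF sub]] by (rule Union_least)
    ultimately show "\<Union>\<C> \<in> \<A>" by (simp add: \<A>_def)
  qed
  then obtain M where M: "M \<in> \<A>" and max: "\<And>X. X \<in> \<A> \<Longrightarrow> M \<subseteq> X \<Longrightarrow> X = M" by blast
  note M' = \<A>D(1,2)[OF M] and fipM = \<A>D(3)[OF M]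
  \<comment> \<open>Maximality in usable form: a subset of \<open>S\<close> that meets all finite
    intersections from \<open>M\<close> cannot be missing from \<open>M\<close>.\<close>
  have inM: "P \<in> M" if P: "P \<subseteq> S" and meets: "\<And>B0. finite B0 \<Longrightarrow> B0 \<subseteq> M \<Longrightarrow> P \<inter> \<Inter>B0 \<noteq> {}" for P
  proof -
    have "S \<inter> \<Inter>B0 \<noteq> {}" if "finite B0" "B0 \<subseteq> insert P M" for B0
    proof -
      have "P \<inter> \<Inter>(B0 - {P}) \<noteq> {}" using meets[of "B0 - {P}"] that by blast
      then show ?thesis using P by blast
    qed
    then have "insert P M \<in> \<A>" using M' P by (auto simp: \<A>_def)
    then have "insert P M = M" using max by blast
    then show ?thesis by blast
  qed
  have "S \<in> M" using inM fipM by blast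
  moreover have "{} \<notin> M" using fipM[of "{{}}"] by auto
  moreover have "P \<inter> Q \<in> M" if "P \<in> M" "Q \<in> M" for P Q
  proof (rule inM)
    show "P \<inter> Q \<subseteq> S" using that M'(2) by blast
    fix B0 assume "finite B0" "B0 \<subseteq> M"
    then have "S \<inter> \<Inter>(insert P (insert Q B0)) \<noteq> {}" using that by (intro fipM) auto
    then show "P \<inter> Q \<inter> \<Inter>B0 \<noteq> {}" by auto
  qed
  moreover have "Q \<in> M" if "P \<in> M" "P \<subseteq> Q" "Q \<subseteq> S" for P Q
  proof (rule inM[OF that(3)])
    fix B0 assume "finite B0" "B0 \<subseteq> M"
    then have "S \<inter> \<Inter>(insert P B0) \<noteq> {}" using that by (intro fipM) auto
    then show "Q \<inter> \<Inter>B0 \<noteq> {}" using that(2) by auto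
  qed
  moreover have "P \<in> M \<or> S - P \<in> M" if P: "P \<subseteq> S" for P
  proof (rule disjCI)
    assume "S - P \<notin> M"
    \<comment> \<open>A finite \<open>B1\<close> witnesses that \<open>S - P\<close> is not in
      \<open>M\<close>; every finite intersection that includes \<open>B1\<close> must therefore
      meet \<open>P\<close>.\<close>
    then obtain B1 where B1: "finite B1" "B1 \<subseteq> M" "(S - P) \<inter> \<Inter>B1 = {}" using inM[of "S - P"] by blast
    show "P \<in> M"
    proof (rule inM[OF P])
      fix B0 assume "finite B0" "B0 \<subseteq> M"
      then have "S \<inter> \<Inter>(B0 \<union> B1) \<noteq> {}" using B1 by (intro fipM) auto
      then show "P \<inter> \<Inter>B0 \<noteq> {}" using B1(3) by blast
    qed
  qed
  ultimately have "ultrafilter_on S M" using M'(2) unfolding ultrafilter_on_def by blast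
  then show ?thesis using M'(1) by blast
qed

text \<open>If no finite subfamily covers, the complements have the finite intersection property,
  and an ultrafilter containing all of them contains no member of the family.\<close>

lemma compact_space_ultrafilters: "compact_space (stone_topology S {U. ultrafilter_on S U})"
proof (rule compact_space_stone)
  fix \<P> assume \<P>: "\<P> \<subseteq> Pow S" "\<forall>U\<in>{U. ultrafilter_on S U}. \<exists>P\<in>\<P>. P \<in> U"
  show "\<exists>\<P>0. finite \<P>0 \<and> \<P>0 \<subseteq> \<P> \<and> (\<forall>F\<in>{U. ultrafilter_on S U}. \<exists>P\<in>\<P>0. P \<in> F)"
  proof (rule ccontr)
    assume none: "\<not> ?thesis"
    have "\<exists>U. ultrafilter_on S U \<and> (\<lambda>P. S - P) ` \<P> \<subseteq> U"
    proof (rule ultrafilter_extension)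
      fix B0 assume B0: "finite B0" "B0 \<subseteq> (\<lambda>P. S - P) ` \<P>"
      then obtain \<P>0 where \<P>0: "\<P>0 \<subseteq> \<P>" "finite \<P>0" "B0 = (\<lambda>P. S - P) ` \<P>0"
        by (meson finite_subset_image)
      have "\<not> (\<forall>F\<in>{U. ultrafilter_on S U}. \<exists>P\<in>\<P>0. P \<in> F)" using none \<P>0(1,2) by blast
      then obtain U where U: "ultrafilter_on S U" "\<And>P. P \<in> \<P>0 \<Longrightarrow> P \<notin> U" by blast
      have compl: "S - P \<in> U" if "P \<in> \<P>0" for P
        using ultrafilter_onD(2)[OF U(1) _ U(2)[OF that]] that \<P>0(1) \<P>(1) by blast
      have "S \<inter> \<Inter>((\<lambda>P. S - P) ` \<P>0) \<in> U" using \<P>0(2) compl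
      proof (induction rule: finite_induct)
        case empty
        then show ?case using U(1) by (simp add: ultrafilter_on_def)
      next
        case (insert P \<Q>)
        then have "(S - P) \<inter> (S \<inter> \<Inter>((\<lambda>P. S - P) ` \<Q>)) \<in> U"
          using U(1) unfolding ultrafilter_on_def by simp
        moreover have "(S - P) \<inter> (S \<inter> \<Inter>((\<lambda>P. S - P) ` \<Q>)) = S \<inter> \<Inter>((\<lambda>P. S - P) ` insert P \<Q>)"
          by auto
        ultimately show ?case by metis
      qed
      moreover have "{} \<notin> U" using U(1) by (simp add: ultrafilter_on_def)
      ultimately show "S \<inter> \<Inter>B0 \<noteq> {}" using \<P>0(3) by metis
    qed blast
    then obtain U where U: "ultrafilter_on S U" "(\<lambda>P. S - P) ` \<P> \<subseteq> U" by blast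
    then obtain P where P: "P \<in> \<P>" "P \<in> U" using \<P>(2) by blast
    note filter = ultrafilter_onD(1)[OF U(1)]
    have "S - P \<in> U" using U(2) P(1) by blast
    then have "P \<inter> (S - P) \<in> U" by (rule proper_filterD(4)[OF filter P(2)])
    then show False using proper_filterD(3)[OF filter] by simp
  qed
qed (simp add: ultrafilter_on_iff)

text \<open>Two ultrafilters differ in some set; one contains it and the other its complement, which
  gives separation.\<close>

lemma Hausdorff_compactification_ultrafilters:
  "Hausdorff_compactification (discrete_topology S) (stone_topology S {U. ultrafilter_on S U}) (principal S)"
proof (rule Hausdorff_compactification_stone)
  fix c assume "c \<in> S"
  then show "principal S c \<in> {U. ultrafilter_on S U}"
    using proper_filter_principal[of c S] by (auto simp: ultrafilter_on_iff principal_def)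
next
  fix F F' assume F: "F \<in> {U. ultrafilter_on S U}" "F' \<in> {U. ultrafilter_on S U}" "F \<noteq> F'"
  then consider P where "P \<in> F" "P \<notin> F'" | P where "P \<in> F'" "P \<notin> F" by blast
  then show "\<exists>P\<in>F. \<exists>Q\<in>F'. P \<inter> Q = {}"
  proof cases
    case (1 P)
    have "ultrafilter_on S F" "ultrafilter_on S F'" using F by simp_all
    then have "S - P \<in> F'" using 1 ultrafilter_onD(2) proper_filterD(1)[OF ultrafilter_onD(1)] by metis
    then show ?thesis using 1 by blast
  next
    case (2 P)
    have "ultrafilter_on S F" "ultrafilter_on S F'" using F by simp_all
    then have "S - P \<in> F" using 2 ultrafilter_onD(2) proper_filterD(1)[OF ultrafilter_onD(1)] by metis
    then show ?thesis using 2 by blast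
  qed
qed (simp_all add: ultrafilter_onD(1) compact_space_ultrafilters)

section \<open>Pushing filters forward along component maps\<close>

context sgraph
begin

text \<open>On filters, \<open>uf_map\<close> is the usual pushforward: upward closure lets the full
  preimage under the component map replace the existential witness.\<close>

lemma uf_map_iff:
  assumes F: "proper_filter (comps G X') F"
  shows "P \<in> uf_map G X' X F \<longleftrightarrow>
    P \<subseteq> comps G X \<and> {C \<in> comps G X'. comp_map G X' X C \<in> P} \<in> F"
proof
  assume "P \<in> uf_map G X' X F"
  then obtain Q where Q: "P \<subseteq> comps G X" "Q \<in> F" "comp_map G X' X ` Q \<subseteq> P"
    by (auto simp: uf_map_def)
  have "Q \<subseteq> {C \<in> comps G X'. comp_map G X' X C \<in> P}" using Q proper_filterD(1)[OF F Q(2)] by blast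
  then show "P \<subseteq> comps G X \<and> {C \<in> comps G X'. comp_map G X' X C \<in> P} \<in> F"
    using proper_filterD(5)[OF F Q(2)] Q(1) by simp
next
  assume "P \<subseteq> comps G X \<and> {C \<in> comps G X'. comp_map G X' X C \<in> P} \<in> F"
  then show "P \<in> uf_map G X' X F"
    unfolding uf_map_def by (intro CollectI conjI bexI[of _ "{C \<in> comps G X'. comp_map G X' X C \<in> P}"]) auto
qed

lemma uf_map_principal:
  assumes "C \<in> comps G X'" "X \<subseteq> X'"
  shows "uf_map G X' X (principal (comps G X') C) = principal (comps G X) (comp_map G X' X C)"
proof (rule set_eqI)
  fix P
  show "P \<in> uf_map G X' X (principal (comps G X') C) \<longleftrightarrow> P \<in> principal (comps G X) (comp_map G X' X C)"
    unfolding uf_map_iff[OF proper_filter_principal[OF assms(1)]]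
    using assms(1) by (auto simp: principal_def)
qed

text \<open>The map \<open>m\<close> stays abstract because \<open>frakF_map\<close> is defined by
  cases and is compared with the pushforward only on the chosen filters. The axioms for bonding maps
  then reduce to identities between preimages.\<close>

lemma C_system_stone:
  fixes \<F> :: "'v set \<Rightarrow> 'v set set set set"
  assumes comp: "\<And>X. X \<in> fin_sets G \<Longrightarrow>
      Hausdorff_compactification (discrete_topology (comps G X)) (stone_topology (comps G X) (\<F> X))
        (principal (comps G X))"
    and filter: "\<And>X F. X \<in> fin_sets G \<Longrightarrow> F \<in> \<F> X \<Longrightarrow> proper_filter (comps G X) F"
    and prin: "\<And>X C. X \<in> fin_sets G \<Longrightarrow> C \<in> comps G X \<Longrightarrow> principal (comps G X) C \<in> \<F> X"
    and map: "\<And>X X' F. X \<in> fin_sets G \<Longrightarrow> X' \<in> fin_sets G \<Longrightarrow> X \<subseteq> X' \<Longrightarrow> F \<in> \<F> X' \<Longrightarrow>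
      m X' X F = uf_map G X' X F \<and> m X' X F \<in> \<F> X"
  shows "C_system G (\<lambda>X. stone_topology (comps G X) (\<F> X)) (principal_uf G) m"
proof -
  let ?A = "\<lambda>X. stone_topology (comps G X) (\<F> X)"
  have top: "topspace (?A X) = \<F> X" if "X \<in> fin_sets G" for X
    using topspace_stone[of "\<F> X" "comps G X"] filter[OF that] by blast
  have m_iff: "P \<in> m X' X F \<longleftrightarrow> P \<subseteq> comps G X \<and> {C \<in> comps G X'. comp_map G X' X C \<in> P} \<in> F"
    if "X \<in> fin_sets G" "X' \<in> fin_sets G" "X \<subseteq> X'" "F \<in> \<F> X'" for P X X' F
    using map[OF that] uf_map_iff[OF filter[OF that(2,4)]] by simp
  have "continuous_map (?A X') (?A X) (m X' X)"
    if X: "X \<in> fin_sets G" "X' \<in> fin_sets G" "X \<subseteq> X'" for X X'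
    unfolding stone_topology_def[of "comps G X"]
  proof (rule continuous_on_generated_topo)
    fix U assume "U \<in> {{F \<in> \<F> X. P \<in> F} |P. P \<subseteq> comps G X}"
    then obtain P where P: "U = {F \<in> \<F> X. P \<in> F}" "P \<subseteq> comps G X" by blast
    have "m X' X -` U \<inter> topspace (?A X') = {F \<in> \<F> X'. {C \<in> comps G X'. comp_map G X' X C \<in> P} \<in> F}"
      using map[OF X] m_iff[OF X] P by (auto simp: top[OF X(2)])
    then show "openin (?A X') (m X' X -` U \<inter> topspace (?A X'))"
      using openin_stone[of "{C \<in> comps G X'. comp_map G X' X C \<in> P}" "comps G X'" "\<F> X'"] by auto
  next
    show "m X' X ` topspace (?A X') \<subseteq> \<Union>{{F \<in> \<F> X. P \<in> F} |P. P \<subseteq> comps G X}"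
    proof -
      have "m X' X ` topspace (?A X') \<subseteq> topspace (?A X)"
        unfolding top[OF X(1)] top[OF X(2)] using map[OF X] by blast
      then show ?thesis unfolding stone_topology_def[of "comps G X"] topology_generated_by_topspace .
    qed
  qed
  moreover have "m X X F = F" if X: "X \<in> fin_sets G" "F \<in> \<F> X" for X F
  proof (rule set_eqI)
    fix P
    have "{C \<in> comps G X. comp_map G X X C \<in> P} = P" if "P \<subseteq> comps G X"
      using that comp_map_refl by force
    then show "P \<in> m X X F \<longleftrightarrow> P \<in> F"
      using m_iff[OF X(1,1) _ X(2), of P] proper_filterD(1)[OF filter[OF X]] by auto
  qed
  moreover have "m X' X (m X'' X' F) = m X'' X F"
    if X: "X \<in> fin_sets G" "X' \<in> fin_sets G" "X'' \<in> fin_sets G" "X \<subseteq> X'" "X' \<subseteq> X''" "F \<in> \<F> X''" for X X' X'' F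
  proof (rule set_eqI)
    fix P
    have "{C \<in> comps G X''. comp_map G X'' X' C \<in> {C \<in> comps G X'. comp_map G X' X C \<in> P}}
        = {C \<in> comps G X''. comp_map G X'' X C \<in> P}"
      using comp_map(1)[OF _ X(5)] comp_map_trans[OF _ X(4,5)] by auto
    moreover have "m X'' X' F \<in> \<F> X'" using map[OF X(2,3,5,6)] by blast
    moreover have "X \<subseteq> X''" using X by blast
    ultimately show "P \<in> m X' X (m X'' X' F) \<longleftrightarrow> P \<in> m X'' X F"
      using m_iff[OF X(1,2,4)] m_iff[OF X(2,3,5,6)] m_iff[OF X(1,3) _ X(6)] by auto
  qed
  moreover have "m X' X (principal (comps G X') C) = principal (comps G X) (comp_map G X' X C)"
    if X: "X \<in> fin_sets G" "X' \<in> fin_sets G" "X \<subseteq> X'" "C \<in> comps G X'" for X X' C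
    using map[OF X(1-3) prin[OF X(2,4)]] uf_map_principal[OF X(4,3)] by simp
  ultimately show ?thesis
    unfolding C_system_def principal_uf_eq using comp by (simp add: top)
qed

text \<open>Preimages respect intersections, complements and the full set, so the ultrafilter axioms
  pass to the pushforward.\<close>

lemma C_system_tangle: "C_system G (uf_space G) (principal_uf G) (uf_map G)"
proof -
  have "C_system G (\<lambda>X. stone_topology (comps G X) {U. ultrafilter_on (comps G X) U})
      (principal_uf G) (uf_map G)"
  proof (rule C_system_stone)
    fix X C assume "C \<in> comps G X"
    then show "principal (comps G X) C \<in> {U. ultrafilter_on (comps G X) U}"
      using proper_filter_principal by (auto simp: ultrafilter_on_iff principal_def)
  next
    fix X X' F assume X: "X \<subseteq> X'" and F: "F \<in> {U. ultrafilter_on (comps G X') U}"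
    let ?pre = "\<lambda>P. {C \<in> comps G X'. comp_map G X' X C \<in> P}"
    have F': "proper_filter (comps G X') F" using F by (simp add: ultrafilter_on_iff)
    have pre: "?pre (comps G X) = comps G X'" using comp_map(1)[OF _ X] by blast
    have "ultrafilter_on (comps G X) (uf_map G X' X F)"
      unfolding ultrafilter_on_def uf_map_iff[OF F'] Ball_def
    proof (intro conjI allI impI)
      show "uf_map G X' X F \<subseteq> Pow (comps G X)" by (auto simp: uf_map_def)
      show "?pre (comps G X) \<in> F" using proper_filterD(2)[OF F'] pre by simp
      show "\<not> ({} \<subseteq> comps G X \<and> ?pre {} \<in> F)" using proper_filterD(3)[OF F'] by simp
    next
      fix P Q assume "P \<subseteq> comps G X \<and> ?pre P \<in> F" "Q \<subseteq> comps G X \<and> ?pre Q \<in> F"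
      moreover have "?pre (P \<inter> Q) = ?pre P \<inter> ?pre Q" by blast
      ultimately show "?pre (P \<inter> Q) \<in> F" "P \<inter> Q \<subseteq> comps G X" using proper_filterD(4)[OF F'] by auto
    next
      fix P Q assume "P \<subseteq> comps G X \<and> ?pre P \<in> F" "P \<subseteq> Q"
      then show "?pre Q \<in> F" using proper_filterD(5)[OF F', of "?pre P" "?pre Q"] by blast
    next
      fix P assume P: "P \<subseteq> comps G X"
      have "?pre (comps G X - P) = comps G X' - ?pre P" using pre by blast
      moreover have "?pre P \<in> F \<or> comps G X' - ?pre P \<in> F" using F by (auto simp: ultrafilter_on_def)
      ultimately show "(P \<subseteq> comps G X \<and> ?pre P \<in> F) \<or> (comps G X - P \<subseteq> comps G X \<and> ?pre (comps G X - P) \<in> F)"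
        using P by auto
    qed auto
    then show "uf_map G X' X F = uf_map G X' X F \<and> uf_map G X' X F \<in> {U. ultrafilter_on (comps G X) U}"
      by simp
  qed (simp_all add: ultrafilter_onD(1) Hausdorff_compactification_ultrafilters)
  then show ?thesis by (simp add: uf_space_def[abs_def])
qed

section \<open>Cofinite filters at critical sets\<close>

lemma crit_filter_iff:
  "P \<in> crit_filter G X Y \<longleftrightarrow> P \<subseteq> comps G X \<and> finite (comps_nbhd G X Y - P)"
proof
  assume "P \<in> crit_filter G X Y"
  then obtain D where D: "P \<subseteq> comps G X" "finite (comps_nbhd G X Y - D)" "D \<subseteq> P"
    by (auto simp: crit_filter_def)
  have "comps_nbhd G X Y - P \<subseteq> comps_nbhd G X Y - D" using D(3) by blast
  then show "P \<subseteq> comps G X \<and> finite (comps_nbhd G X Y - P)" using D finite_subset by blast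
next
  assume P: "P \<subseteq> comps G X \<and> finite (comps_nbhd G X Y - P)"
  have "comps_nbhd G X Y - comps_nbhd G X Y \<inter> P = comps_nbhd G X Y - P" by blast
  then show "P \<in> crit_filter G X Y" using P unfolding crit_filter_def by (metis (mono_tags, lifting) inf_le1 inf_le2 mem_Collect_eq)
qed

lemma comps_nbhd_sub: "comps_nbhd G X Y \<subseteq> comps G X"
  by (auto simp: comps_nbhd_def)

text \<open>Infinity of \<open>comps_nbhd G X Y\<close>, the defining property of a critical set, is
  what keeps the empty set out.\<close>

lemma proper_filter_crit:
  assumes "Y \<in> crit G X"
  shows "proper_filter (comps G X) (crit_filter G X Y)"
proof -
  have "infinite (comps_nbhd G X Y)" using assms by (simp add: crit_def)
  moreover have "finite (comps_nbhd G X Y - comps G X)" using comps_nbhd_sub by (simp add: Diff_eq_empty_iff[THEN iffD2])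
  moreover have "comps_nbhd G X Y - P \<inter> Q = (comps_nbhd G X Y - P) \<union> (comps_nbhd G X Y - Q)" for P Q
    by blast
  moreover have "P \<subseteq> Q \<Longrightarrow> finite (comps_nbhd G X Y - P) \<Longrightarrow> finite (comps_nbhd G X Y - Q)" for P Q
    by (meson Diff_mono finite_subset order_refl)
  ultimately show ?thesis by (auto simp: proper_filter_def crit_filter_iff)
qed

lemma frakF_cases:
  assumes "F \<in> frakF_set G X"
  obtains C where "C \<in> comps G X" "F = principal (comps G X) C"
    | Y where "Y \<in> crit G X" "F = crit_filter G X Y"
  using assms by (auto simp: frakF_set_def principal_uf_eq)

lemma proper_filter_frakF:
  assumes "F \<in> frakF_set G X"
  shows "proper_filter (comps G X) F"
  using assms by (rule frakF_cases) (simp_all add: proper_filter_principal proper_filter_crit)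

text \<open>A cofinite filter ignores any single component, so \<open>{C}\<close> and its complement
  separate it from a principal filter.\<close>

lemma crit_principal_sep:
  assumes "C \<in> comps G X"
  shows "{C} \<in> principal (comps G X) C" "comps G X - {C} \<in> crit_filter G X Y"
proof -
  have "comps_nbhd G X Y - (comps G X - {C}) \<subseteq> {C}" using comps_nbhd_sub by blast
  then show "comps G X - {C} \<in> crit_filter G X Y" unfolding crit_filter_iff using finite_subset by blast
qed (use assms in \<open>simp add: principal_def\<close>)

lemma frakF_sep:
  assumes "F \<in> frakF_set G X" "F' \<in> frakF_set G X" "F \<noteq> F'"
  shows "\<exists>P\<in>F. \<exists>Q\<in>F'. P \<inter> Q = {}"
  using assms(1)
proof (rule frakF_cases)
  fix C assume C: "C \<in> comps G X" "F = principal (comps G X) C"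
  show ?thesis
    using assms(2)
  proof (rule frakF_cases)
    fix D assume D: "D \<in> comps G X" "F' = principal (comps G X) D"
    then have "{C} \<inter> {D} = {}" using C assms(3) by auto
    then show ?thesis using crit_principal_sep(1) C D by metis
  next
    fix Y assume Y: "Y \<in> crit G X" "F' = crit_filter G X Y"
    have "{C} \<inter> (comps G X - {C}) = {}" by blast
    then show ?thesis using crit_principal_sep[OF C(1)] C(2) Y(2) by metis
  qed
next
  fix Y assume Y: "Y \<in> crit G X" "F = crit_filter G X Y"
  show ?thesis
    using assms(2)
  proof (rule frakF_cases)
    fix C assume C: "C \<in> comps G X" "F' = principal (comps G X) C"
    have "(comps G X - {C}) \<inter> {C} = {}" by blast
    then show ?thesis using crit_principal_sep[OF C(1)] C(2) Y(2) by metis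
  next
    fix Z assume Z: "Z \<in> crit G X" "F' = crit_filter G X Z"
    \<comment> \<open>A component has only one neighbourhood, so different critical sets have
      disjoint classes, and each class belongs to its own filter.\<close>
    then have "comps_nbhd G X Y \<inter> comps_nbhd G X Z = {}" using Y assms(3) by (auto simp: comps_nbhd_def)
    moreover have "comps_nbhd G X Y \<in> F" "comps_nbhd G X Z \<in> F'"
      using Y Z comps_nbhd_sub by (simp_all add: crit_filter_iff)
    ultimately show ?thesis by blast
  qed
qed

lemma crit_filter_not_principal:
  assumes "C \<in> comps G X" "Y \<in> crit G X"
  shows "crit_filter G X Y \<noteq> principal (comps G X) C"
proof
  assume "crit_filter G X Y = principal (comps G X) C"
  then have "comps G X - {C} \<in> principal (comps G X) C" using crit_principal_sep(2)[OF assms(1)] by metis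
  then show False by (simp add: principal_def)
qed

text \<open>The class of \<open>Z\<close> belongs to the filter of \<open>Z\<close>, but by
  disjointness it misses the whole infinite class of \<open>Y\<close>. This lets
  \<open>frakF_map\<close> recover the critical set from the filter.\<close>

lemma crit_filter_inj:
  assumes "Y \<in> crit G X" "crit_filter G X Y = crit_filter G X Z"
  shows "Y = Z"
proof (rule ccontr)
  assume "Y \<noteq> Z"
  then have "comps_nbhd G X Y - comps_nbhd G X Z = comps_nbhd G X Y" by (auto simp: comps_nbhd_def)
  moreover have "comps_nbhd G X Z \<in> crit_filter G X Y"
    unfolding assms(2) crit_filter_iff using comps_nbhd_sub by simp
  ultimately show False using assms(1) by (simp add: crit_filter_iff crit_def)
qed

text \<open>For each critical set some member of the family misses only finitely many components of
  its class. As \<open>X\<close> has finitely many subsets and every component has its neighbourhood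
  inside \<open>X\<close>, only finitely many components remain; they are covered one by
  one.\<close>

lemma compact_frakF:
  assumes X: "X \<in> fin_sets G"
  shows "compact_space (stone_topology (comps G X) (frakF_set G X))"
proof (rule compact_space_stone)
  fix \<P> assume \<P>: "\<P> \<subseteq> Pow (comps G X)" "\<forall>F\<in>frakF_set G X. \<exists>P\<in>\<P>. P \<in> F"
  have fin_X: "finite X" using X by (simp add: fin_sets_def)
  have "\<forall>Y\<in>crit G X. \<exists>P\<in>\<P>. P \<in> crit_filter G X Y" using \<P>(2) by (auto simp: frakF_set_def)
  then obtain p where p: "\<And>Y. Y \<in> crit G X \<Longrightarrow> p Y \<in> \<P> \<and> p Y \<in> crit_filter G X Y" by metis
  have "\<forall>C\<in>comps G X. \<exists>P\<in>\<P>. P \<in> principal (comps G X) C"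
    using \<P>(2) by (auto simp: frakF_set_def principal_uf_eq)
  then obtain q where q: "\<And>C. C \<in> comps G X \<Longrightarrow> q C \<in> \<P> \<and> q C \<in> principal (comps G X) C" by metis
  have fin_crit: "finite (crit G X)"
    using fin_X by (auto simp: crit_def intro: finite_subset[of _ "Pow X"])
  define R where "R = {C \<in> comps G X. \<forall>Y\<in>crit G X. C \<notin> p Y}"
  \<comment> \<open>For noncritical \<open>Y\<close> the class itself is finite; for critical
    \<open>Y\<close> what \<open>p Y\<close> leaves of it is finite.\<close>
  have "finite (\<Union>Y\<in>Pow X. if Y \<in> crit G X then comps_nbhd G X Y - p Y else comps_nbhd G X Y)"
    using fin_X p by (auto simp: crit_filter_iff crit_def)
  moreover have "R \<subseteq> (\<Union>Y\<in>Pow X. if Y \<in> crit G X then comps_nbhd G X Y - p Y else comps_nbhd G X Y)"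
  proof
    fix C assume C: "C \<in> R"
    then have "nbhd G C \<in> Pow X" "C \<in> comps_nbhd G X (nbhd G C)"
      using nbhd_comps by (auto simp: R_def comps_nbhd_def)
    moreover have "nbhd G C \<in> crit G X \<Longrightarrow> C \<notin> p (nbhd G C)" using C by (auto simp: R_def)
    ultimately show "C \<in> (\<Union>Y\<in>Pow X. if Y \<in> crit G X then comps_nbhd G X Y - p Y else comps_nbhd G X Y)"
      by (intro UN_I[of "nbhd G C"]) auto
  qed
  ultimately have fin_R: "finite R" using finite_subset by blast
  have "\<exists>P\<in>p ` crit G X \<union> q ` R. P \<in> F" if "F \<in> frakF_set G X" for F
    using that
  proof (rule frakF_cases)
    fix C assume C: "C \<in> comps G X" "F = principal (comps G X) C"
    show ?thesis
    proof (cases "C \<in> R")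
      case True
      then show ?thesis using q C by blast
    next
      case False
      then obtain Y where "Y \<in> crit G X" "C \<in> p Y" using C by (auto simp: R_def)
      moreover have "p Y \<subseteq> comps G X" using p \<P>(1) \<open>Y \<in> crit G X\<close> by blast
      ultimately show ?thesis using C(2) by (auto simp: principal_def)
    qed
  next
    fix Y assume "Y \<in> crit G X" "F = crit_filter G X Y"
    then show ?thesis using p by blast
  qed
  moreover have "finite (p ` crit G X \<union> q ` R)" using fin_crit fin_R by simp
  moreover have "p ` crit G X \<union> q ` R \<subseteq> \<P>" using p q by (auto simp: R_def)
  ultimately show "\<exists>\<P>0. finite \<P>0 \<and> \<P>0 \<subseteq> \<P> \<and> (\<forall>F\<in>frakF_set G X. \<exists>P\<in>\<P>0. P \<in> F)"
    by (intro exI[of _ "p ` crit G X \<union> q ` R"]) simp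
qed (rule proper_filter_frakF)

lemma frakF_map_principal:
  assumes C: "C \<in> comps G X'" and X: "X \<subseteq> X'"
  shows "frakF_map G X' X (principal (comps G X') C) = principal (comps G X) (comp_map G X' X C)"
proof -
  have "(THE D. D \<in> comps G X' \<and> principal (comps G X') C = principal (comps G X') D) = C"
  proof (rule the_equality)
    fix D assume "D \<in> comps G X' \<and> principal (comps G X') C = principal (comps G X') D"
    then have "{C} \<in> principal (comps G X') D" using crit_principal_sep(1)[OF C] by metis
    then show "D = C" by (simp add: principal_def)
  qed (use C in simp)
  then show ?thesis using C by (simp add: frakF_map_def principal_uf_eq)
qed

text \<open>A critical filter is never principal, so the second branch of the definition applies,
  and injectivity resolves its definite description.\<close>

lemma frakF_map_crit:
  assumes Y: "Y \<in> crit G X'"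
  shows "frakF_map G X' X (crit_filter G X' Y) =
    (if Y \<subseteq> X then crit_filter G X Y
     else principal (comps G X) (THE C. C \<in> comps G X \<and> \<Union>(comps_nbhd G X' Y) \<subseteq> C))"
proof -
  have "(THE Z. Z \<in> crit G X' \<and> crit_filter G X' Y = crit_filter G X' Z) = Y"
    using Y crit_filter_inj[OF Y] by (intro the_equality) auto
  moreover have "crit_filter G X' Y \<notin> principal (comps G X') ` comps G X'"
    using crit_filter_not_principal[OF _ Y] by blast
  ultimately show ?thesis by (simp add: frakF_map_def principal_uf_eq)
qed

text \<open>The cases of \<open>frakF_map\<close> reflect how a class of components behaves on
  passing from \<open>X'\<close> to \<open>X\<close>: if \<open>Y \<subseteq> X\<close> its
  components stay as they are, otherwise they all merge into one component.\<close>

lemma frakF_map_eq_uf_map: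
  assumes fin: "finite X'" "X' \<subseteq> verts G" and X: "X \<subseteq> X'" and F: "F \<in> frakF_set G X'"
  shows "frakF_map G X' X F = uf_map G X' X F \<and> frakF_map G X' X F \<in> frakF_set G X"
  using F
proof (rule frakF_cases)
  fix C assume C: "C \<in> comps G X'" "F = principal (comps G X') C"
  then show ?thesis
    using frakF_map_principal[OF C(1) X] uf_map_principal[OF C(1) X] comp_map(1)[OF C(1) X]
    by (simp add: frakF_set_def principal_uf_eq)
next
  fix Y assume Y: "Y \<in> crit G X'" "F = crit_filter G X' Y"
  have inf: "infinite (comps_nbhd G X' Y)" using Y(1) by (simp add: crit_def)
  let ?pre = "\<lambda>P. {C \<in> comps G X'. comp_map G X' X C \<in> P}"
  have uf: "P \<in> uf_map G X' X F \<longleftrightarrow> P \<subseteq> comps G X \<and> finite (comps_nbhd G X' Y - ?pre P)" for P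
    unfolding Y(2) uf_map_iff[OF proper_filter_crit[OF Y(1)]] crit_filter_iff by blast
  show ?thesis
  proof (cases "Y \<subseteq> X")
    case True
    have coarse: "C \<in> comps G X \<and> comp_map G X' X C = C" if "C \<in> comps_nbhd G X' Y" for C
    proof -
      have C: "C \<in> comps G X'" "nbhd G C \<subseteq> X" using that True by (auto simp: comps_nbhd_def)
      obtain v where "v \<in> C" using comps_nonempty[OF C(1)] by blast
      then show ?thesis using comps_coarsen[OF C(1) X C(2)] comp_map_eq[OF C(1) X] by blast
    qed
    have sub: "comps_nbhd G X' Y \<subseteq> comps_nbhd G X Y" using coarse by (auto simp: comps_nbhd_def)
    \<comment> \<open>What level \<open>X\<close> has in addition are components meeting the finite
      \<open>X'\<close>, so the two classes differ finitely and yield the same cofiniteness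
      condition.\<close>
    have "comps_nbhd G X Y - comps_nbhd G X' Y \<subseteq> {C \<in> comps G X. C \<inter> X' \<noteq> {}}"
      using comps_refine[OF _ X] by (auto simp: comps_nbhd_def)
    then have fin_diff: "finite (comps_nbhd G X Y - comps_nbhd G X' Y)"
      using finite_comps_meeting[OF fin(1)] finite_subset by blast
    have "P \<in> uf_map G X' X F \<longleftrightarrow> P \<in> crit_filter G X Y" for P
    proof -
      have "comps_nbhd G X' Y - ?pre P = comps_nbhd G X' Y - P"
        using coarse comps_nbhd_sub[of X' Y] by force
      moreover have "finite (comps_nbhd G X' Y - P) \<longleftrightarrow> finite (comps_nbhd G X Y - P)"
      proof
        assume "finite (comps_nbhd G X' Y - P)"
        then have "finite ((comps_nbhd G X' Y - P) \<union> (comps_nbhd G X Y - comps_nbhd G X' Y))"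
          using fin_diff by simp
        then show "finite (comps_nbhd G X Y - P)" by (rule rev_finite_subset) blast
      next
        assume "finite (comps_nbhd G X Y - P)"
        then show "finite (comps_nbhd G X' Y - P)" by (rule rev_finite_subset) (use sub in blast)
      qed
      ultimately show ?thesis unfolding uf crit_filter_iff by simp
    qed
    then have "uf_map G X' X F = crit_filter G X Y" by blast
    moreover have "Y \<in> crit G X" using True inf sub finite_subset by (auto simp: crit_def)
    ultimately show ?thesis using frakF_map_crit[OF Y(1), of X] Y(2) True by (simp add: frakF_set_def)
  next
    case False
    then obtain y where y: "y \<in> Y" "y \<notin> X" by blast
    have "Y \<subseteq> X'" using Y(1) by (simp add: crit_def)
    then have "y \<in> verts G" using y(1) fin(2) by blast
    then obtain C where C: "C \<in> comps G X" "y \<in> C" using comps_cover[of y G X] y(2) by blast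
    \<comment> \<open>Each \<open>D\<close> in the class is adjacent to \<open>y\<close>, which is
      not deleted at level \<open>X\<close>, so all of them land in the component \<open>C\<close>
      of \<open>y\<close>.\<close>
    have const: "comp_map G X' X D = C" if D: "D \<in> comps_nbhd G X' Y" for D
    proof -
      have D': "D \<in> comps G X'" "y \<in> nbhd G D" using D y(1) by (auto simp: comps_nbhd_def)
      then obtain c where c: "c \<in> D" "{y, c} \<in> edges G" by (auto simp: nbhd_def)
      have "c \<in> C"
        using comps_edge[OF C c(2)] comps_subset[OF D'(1)] c(1) X by blast
      then show ?thesis using comp_map_eq[OF D'(1) X C(1)] c(1) by blast
    qed
    obtain D0 where D0: "D0 \<in> comps_nbhd G X' Y" using inf by (metis ex_in_conv finite.emptyI)
    have in_C: "D \<subseteq> C" if "D \<in> comps_nbhd G X' Y" for D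
      using comp_map(2)[OF _ X, of D] const[OF that] comps_nbhd_sub[of X' Y] that by blast
    have the: "(THE C. C \<in> comps G X \<and> \<Union>(comps_nbhd G X' Y) \<subseteq> C) = C"
    proof (rule the_equality)
      show "C \<in> comps G X \<and> \<Union>(comps_nbhd G X' Y) \<subseteq> C" using C in_C by blast
      fix E assume E: "E \<in> comps G X \<and> \<Union>(comps_nbhd G X' Y) \<subseteq> E"
      obtain v where "v \<in> D0" using comps_nonempty[of D0 G X'] D0 comps_nbhd_sub by blast
      then have "v \<in> E" "v \<in> C" using E D0 in_C by blast+
      then show "E = C" using comps_eq[of E G X C v] E C(1) by blast
    qed
    \<comment> \<open>As the component map is constant on the class, the preimage of
      \<open>P\<close> contains either the whole infinite class or none of it.\<close>
    have "P \<in> uf_map G X' X F \<longleftrightarrow> P \<in> principal (comps G X) C" for P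
    proof (cases "C \<in> P")
      case True
      then have "comps_nbhd G X' Y - ?pre P = {}" using const comps_nbhd_sub[of X' Y] by auto
      then have "finite (comps_nbhd G X' Y - ?pre P)" by (simp only: finite.emptyI)
      then show ?thesis unfolding uf using True by (simp add: principal_def)
    next
      case False
      then have "comps_nbhd G X' Y - ?pre P = comps_nbhd G X' Y" using const by auto
      then show ?thesis unfolding uf using False inf by (simp add: principal_def)
    qed
    then have "uf_map G X' X F = principal (comps G X) C" by blast
    then show ?thesis
      using frakF_map_crit[OF Y(1), of X] Y(2) False the C(1) by (simp add: frakF_set_def principal_uf_eq)
  qed
qed

lemma C_system_frakF: "C_system G (frakF_level G) (principal_uf G) (frakF_map G)"
proof -
  have "C_system G (\<lambda>X. stone_topology (comps G X) (frakF_set G X)) (principal_uf G) (frakF_map G)"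
  proof (rule C_system_stone)
    fix X assume X: "X \<in> fin_sets G"
    show "Hausdorff_compactification (discrete_topology (comps G X))
        (stone_topology (comps G X) (frakF_set G X)) (principal (comps G X))"
    proof (rule Hausdorff_compactification_stone)
      show "principal (comps G X) C \<in> frakF_set G X" if "C \<in> comps G X" for C
        using that by (simp add: frakF_set_def principal_uf_eq)
    qed (simp_all add: proper_filter_frakF frakF_sep compact_frakF[OF X])
  next
    fix X X' F assume "X' \<in> fin_sets G" "X \<subseteq> X'" "F \<in> frakF_set G X'"
    then show "frakF_map G X' X F = uf_map G X' X F \<and> frakF_map G X' X F \<in> frakF_set G X"
      by (intro frakF_map_eq_uf_map) (auto simp: fin_sets_def)
  qed (auto simp: proper_filter_frakF frakF_set_def principal_uf_eq)
  then show ?thesis by (simp add: frakF_level_def[abs_def])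
qed

end

theorem theorem5p4p1:
  fixes G :: "'v graph"
  assumes "simple_graph G" and "infinite (verts G)"
  shows "(\<forall>(A :: 'v set \<Rightarrow> 'a topology) \<alpha> \<aa>. C_system G A \<alpha> \<aa> \<longrightarrow>
            Omega_compactification G (induced_space G A \<alpha> \<aa>) (induced_inclusion G \<alpha>)) \<and>
         Omega_compactification G (frakF_space G) (induced_inclusion G (principal_uf G)) \<and>
         Omega_compactification G (tangle_space G) (induced_inclusion G (principal_uf G))"
proof -
  interpret sgraph G by unfold_locales (rule assms(1))
  have "Omega_compactification G (induced_space G A \<alpha> \<aa>) (induced_inclusion G \<alpha>)"
    if "C_system G A \<alpha> \<aa>" for A :: "'v set \<Rightarrow> 'a topology" and \<alpha> \<aa>
  proof -
    interpret csystem G A \<alpha> \<aa> by unfold_locales (use assms(2) that in \<open>simp_all\<close>)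
    show ?thesis by (rule Omega_compactification_induced)
  qed
  \<comment> \<open>The level type of the first conjunct is the fixed \<open>'a\<close>, so the
    special cases apply the locale result at their own level type.\<close>
  moreover have "Omega_compactification G (frakF_space G) (induced_inclusion G (principal_uf G))"
  proof -
    interpret csystem G "frakF_level G" "principal_uf G" "frakF_map G"
      by unfold_locales (rule assms(2) C_system_frakF)+
    show ?thesis unfolding frakF_space_def by (rule Omega_compactification_induced)
  qed
  moreover have "Omega_compactification G (tangle_space G) (induced_inclusion G (principal_uf G))"
  proof -
    interpret csystem G "uf_space G" "principal_uf G" "uf_map G"
      by unfold_locales (rule assms(2) C_system_tangle)+
    show ?thesis unfolding tangle_space_def by (rule Omega_compactification_induced)
  qed
  ultimately show ?thesis by blast
qed

end
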